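(* Let $\Omega\subset\mathbb{R}^d$ be a (Lebesgue measurable) set of positive and finite measure. Then: (i) If $1<p<2$, then the space $L^p(\Omega)$ does not admit any unconditional Schauder frame of exponentials, i.e. there is no unconditional Schauder frame in $L^p(\Omega)$ of the form $\{(e_\lambda,e_\lambda^* )\}_{\lambda\in\Lambda}$, where $\Lambda\subset\mathbb{R}^d$ is any countable set and $\{e_\lambda^*\}_{\lambda\in\Lambda}$ are arbitrary elements of the dual space $(L^p(\Omega))^*$. (ii) The same conclusion holds for $2<p<+\infty$ provided that $\Omega$ has nonempty interior.
   Context: $L^p(\Omega)$ is the space of complex-valued $p$-integrable functions on $\Omega$ with respect to Lebesgue measure. For $\lambda\in\mathbb{R}^d$, $e_\lambda$ denotes the exponential function $e_\lambda(x)=e^{2\pi i\langle\lambda,x\rangle}$, regarded as an element of $L^p(\Omega)$. If $X$ is a separable Banach space with dual space $X^*$, a countable system $\{(u_n,u_n^* )\}\subset X\times X^*$ is called an unconditional Schauder frame if for every $x\in X$ the series $\sum_n u_n^*(x)u_n$ converges unconditionally (i.e. for every rearrangement of its terms) in the norm of $X$ and its sum is $x$. *)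

theory Defs
  imports "HOL-Analysis.Analysis"
begin

text \<open>
  The space \<open>L\<^sup>p(\<Omega>)\<close> is handled through representatives: its elements are functions, and two of them
  are identified when their difference has \<open>L\<^sup>p\<close> seminorm zero, that is, when they agree almost
  everywhere on \<open>\<Omega>\<close>. Values outside \<open>\<Omega>\<close> play no role, because the measure is \<open>lebesgue_on \<Omega>\<close>.
\<close>

definition Lp_space :: "real \<Rightarrow> 'a::euclidean_space set \<Rightarrow> ('a \<Rightarrow> complex) set" where
  "Lp_space p \<Omega> = {f. f \<in> borel_measurable (lebesgue_on \<Omega>) \<and>
                      integrable (lebesgue_on \<Omega>) (\<lambda>x. norm (f x) powr p)}"

definition Lp_norm :: "real \<Rightarrow> 'a::euclidean_space set \<Rightarrow> ('a \<Rightarrow> complex) \<Rightarrow> real" where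
  "Lp_norm p \<Omega> f = (\<integral>x. norm (f x) powr p \<partial>lebesgue_on \<Omega>) powr (1 / p)"

text \<open>
  Boundedness with respect to the seminorm, together with linearity, makes such a functional constant
  on almost-everywhere classes, so these are exactly the continuous linear functionals on the
  quotient. The values of a functional outside \<open>Lp_space p \<Omega>\<close> are unconstrained.
\<close>

definition Lp_dual :: "real \<Rightarrow> 'a::euclidean_space set \<Rightarrow> (('a \<Rightarrow> complex) \<Rightarrow> complex) set" where
  "Lp_dual p \<Omega> = {\<phi>.
     (\<forall>f\<in>Lp_space p \<Omega>. \<forall>g\<in>Lp_space p \<Omega>. \<phi> (\<lambda>x. f x + g x) = \<phi> f + \<phi> g) \<and>
     (\<forall>c. \<forall>f\<in>Lp_space p \<Omega>. \<phi> (\<lambda>x. c * f x) = c * \<phi> f) \<and>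
     (\<exists>C. \<forall>f\<in>Lp_space p \<Omega>. norm (\<phi> f) \<le> C * Lp_norm p \<Omega> f)}"

text \<open>
  Unconditional convergence in the \<open>L\<^sup>p\<close> norm of the series of the \<open>g i\<close>, \<open>i \<in> I\<close>, with sum \<open>f\<close>. For
  infinite \<open>I\<close> the rearrangements of the series are the bijections from the natural numbers onto \<open>I\<close>.
  There are none when \<open>I\<close> is finite or uncountable: the finite case is therefore separate, and
  countability of \<open>I\<close> has to be demanded wherever this predicate is used.
\<close>

definition Lp_sums_unconditionally ::
    "real \<Rightarrow> 'a::euclidean_space set \<Rightarrow> 'i set \<Rightarrow> ('i \<Rightarrow> 'a \<Rightarrow> complex) \<Rightarrow> ('a \<Rightarrow> complex) \<Rightarrow> bool" where
  "Lp_sums_unconditionally p \<Omega> I g f \<longleftrightarrow>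
     (if finite I then Lp_norm p \<Omega> (\<lambda>x. (\<Sum>i\<in>I. g i x) - f x) = 0
      else \<forall>\<sigma>::nat \<Rightarrow> 'i. bij_betw \<sigma> UNIV I \<longrightarrow>
             (\<lambda>n. Lp_norm p \<Omega> (\<lambda>x. (\<Sum>k<n. g (\<sigma> k) x) - f x)) \<longlonglongrightarrow> 0)"

definition unconditional_Schauder_frame ::
    "real \<Rightarrow> 'a::euclidean_space set \<Rightarrow> 'i set \<Rightarrow> ('i \<Rightarrow> 'a \<Rightarrow> complex) \<Rightarrow>
     ('i \<Rightarrow> ('a \<Rightarrow> complex) \<Rightarrow> complex) \<Rightarrow> bool" where
  "unconditional_Schauder_frame p \<Omega> I u \<phi> \<longleftrightarrow>
     countable I \<and>
     (\<forall>i\<in>I. u i \<in> Lp_space p \<Omega> \<and> \<phi> i \<in> Lp_dual p \<Omega>) \<and>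
     (\<forall>f\<in>Lp_space p \<Omega>. Lp_sums_unconditionally p \<Omega> I (\<lambda>i x. \<phi> i f * u i x) f)"

definition exponential :: "'a::euclidean_space \<Rightarrow> 'a \<Rightarrow> complex" where
  "exponential l x = exp (2 * of_real pi * \<i> * of_real (l \<bullet> x))"

end

theory Submission
  imports Defs
begin

text \<open>
  Write \<open>q\<close> for the exponent dual to \<open>p\<close> and \<open>e\<^sub>l\<close> for the exponential of frequency \<open>l\<close>, and suppose
  that the \<open>e\<^sub>l\<close> with functionals \<open>\<phi>\<^sub>l\<close> form an unconditional Schauder frame. Uniform boundedness turns
  unconditional convergence into one constant \<open>C\<close> such that, for all \<open>f\<close> and all \<open>h\<close> of modulus one on
  a set of finite measure and zero off it,
  \<open>\<Sum>\<^sub>l \<bar>\<phi>\<^sub>l f\<bar> * \<bar>\<integral> e\<^sub>l h\<bar> \<le> C * \<parallel>f\<parallel>\<^sub>p * \<parallel>h\<parallel>\<^sub>q\<close> (lemma \<open>frame_absolute_bound\<close>),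
  and the frame expansion of \<open>f\<close> shows that the left-hand side is at least \<open>\<bar>\<integral> f h\<bar>\<close> (lemma
  \<open>frame_pairing_le\<close>). Only the sizes of the numbers \<open>\<integral> e\<^sub>l h\<close> enter. Hence, if
  \<open>\<bar>\<integral> e\<^sub>l h\<bar> \<le> \<delta> * \<bar>\<integral> e\<^sub>l g\<bar>\<close> for every frequency \<open>l\<close>, then \<open>\<bar>\<integral> f h\<bar> \<le> \<delta> * C * \<parallel>f\<parallel>\<^sub>p * \<parallel>g\<parallel>\<^sub>q\<close>. It
  remains to find \<open>h\<close> and \<open>g\<close> for which this is absurd.

  Translating a function multiplies its pairing with \<open>e\<^sub>l\<close> by a number of modulus one. Let \<open>N\<close> be a power
  of two and choose a compact set \<open>E\<close> of positive measure \<open>\<mu>\<close> with disjoint translates \<open>E + k t\<close>, \<open>k < N\<close>,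
  inside \<open>\<Omega>\<close> (lemma \<open>exists_separated_translates\<close>). For signs \<open>a\<^sub>k\<close> put
  \<open>g = \<Sum>\<^sub>k a\<^sub>k * 1\<^bsub>E + k t\<^esub>\<close>. Then \<open>\<integral> e\<^sub>l g = P (e\<^sub>l t) * \<integral> e\<^sub>l 1\<^sub>E\<close> with the polynomial \<open>P\<close> that has the
  coefficients \<open>a\<^sub>k\<close>, whereas \<open>\<parallel>g\<parallel>\<^sub>q = (N * \<mu>) powr (1 / q)\<close> for any signs. The Rudin--Shapiro
  polynomials \<open>P\<close>, \<open>Q\<close> satisfy \<open>\<bar>P\<bar>\<^sup>2 + \<bar>Q\<bar>\<^sup>2 = 2 * N\<close> on the unit circle, so on the frequency side
  these functions cost or gain a factor of order \<open>sqrt N\<close>, uniformly in \<open>l\<close>; this differs from the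
  factor \<open>N powr (1 / q)\<close> in the norm, because \<open>q\<close> is not \<open>2\<close>.

  For \<open>p < 2\<close>, take \<open>f = h = 1\<^sub>E\<close>: since \<open>sqrt N \<le> \<bar>P\<bar> + \<bar>Q\<bar>\<close>, the numbers \<open>\<integral> e\<^sub>l 1\<^sub>E\<close> are controlled by
  the two signed sums, and \<open>\<mu> \<le> 2 * C * N powr (1 / q - 1 / 2) * \<mu>\<close>. For \<open>p > 2\<close>, exchange the roles: take
  for \<open>f = h\<close> the signed sum belonging to \<open>P\<close>, whose pairings with the exponentials are at most
  \<open>2 * sqrt N\<close> times those of \<open>1\<^sub>E\<close>; then \<open>N * \<mu> \<le> 2 * C * N powr (1 / 2 + 1 / p) * \<mu>\<close>. In both cases
  \<open>N powr \<bar>1 / 2 - 1 / p\<bar> \<le> 2 * C\<close>, which fails for large \<open>N\<close>.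
\<close>

section \<open>The seminorm of L^p\<close>

lemma Lp_normI:
  assumes [measurable]: "f \<in> borel_measurable (lebesgue_on \<Omega>)" and p: "0 < p" and a: "0 \<le> a"
    and le: "(\<integral>\<^sup>+x. ennreal (norm (f x) powr p) \<partial>lebesgue_on \<Omega>) \<le> ennreal (a powr p)"
  shows "f \<in> Lp_space p \<Omega>" and "Lp_norm p \<Omega> f \<le> a"
proof -
  have int: "integrable (lebesgue_on \<Omega>) (\<lambda>x. norm (f x) powr p)"
    using le by (intro integrableI_nonneg) (auto intro: le_less_trans)
  then show "f \<in> Lp_space p \<Omega>"
    by (simp add: Lp_space_def)
  have "ennreal (\<integral>x. norm (f x) powr p \<partial>lebesgue_on \<Omega>) \<le> ennreal (a powr p)"
    using le nn_integral_eq_integral[OF int] by simp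
  then have *: "(\<integral>x. norm (f x) powr p \<partial>lebesgue_on \<Omega>) \<le> a powr p"
    by (simp add: ennreal_le_iff)
  have "Lp_norm p \<Omega> f \<le> (a powr p) powr (1 / p)"
    unfolding Lp_norm_def using p * by (intro powr_mono2) auto
  also have "\<dots> = a"
    using p a by (simp add: powr_powr)
  finally show "Lp_norm p \<Omega> f \<le> a" .
qed

lemma Lp_norm_nonneg [simp]: "0 \<le> Lp_norm p \<Omega> f"
  by (simp add: Lp_norm_def)

lemma Lp_nn_integral:
  assumes f: "f \<in> Lp_space p \<Omega>" and p: "0 < p"
  shows "(\<integral>\<^sup>+x. ennreal (norm (f x) powr p) \<partial>lebesgue_on \<Omega>) = ennreal (Lp_norm p \<Omega> f powr p)"
proof -
  have "(\<integral>\<^sup>+x. ennreal (norm (f x) powr p) \<partial>lebesgue_on \<Omega>)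
      = ennreal (\<integral>x. norm (f x) powr p \<partial>lebesgue_on \<Omega>)"
    using f by (intro nn_integral_eq_integral) (auto simp: Lp_space_def)
  also have "(\<integral>x. norm (f x) powr p \<partial>lebesgue_on \<Omega>) = Lp_norm p \<Omega> f powr p"
    using p by (simp add: Lp_norm_def powr_powr)
  finally show ?thesis .
qed

lemma Lp_measurable: "f \<in> Lp_space p \<Omega> \<Longrightarrow> f \<in> borel_measurable (lebesgue_on \<Omega>)"
  by (simp add: Lp_space_def)

lemma powr_weight_eq:
  fixes a s u p :: real
  assumes "0 < a" "0 < s" "0 \<le> u"
  shows "(s / a) powr (p - 1) * u powr p = a / s * (u * s / a) powr p"
proof -
  have "(u * s / a) powr p = (s / a) powr (p - 1 + 1) * u powr p"
    using assms powr_mult[of "s/a" u p] by (simp add: mult.commute)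
  also have "\<dots> = (s / a) powr (p - 1) * (s / a) * u powr p"
    using assms by (subst powr_add) simp
  finally show ?thesis using assms by simp
qed

text \<open>
  This is convexity of \<open>x powr p\<close>, written with the weights \<open>a / (a + b)\<close> and \<open>b / (a + b)\<close>. With \<open>a\<close> and \<open>b\<close>
  upper bounds for the norms of two functions, integrating it gives Minkowski's inequality with the
  sharp constant.
\<close>

lemma powr_add_le_weighted:
  fixes u v a b p :: real
  assumes "0 \<le> u" "0 \<le> v" "0 < a" "0 < b" "1 \<le> p"
  shows "(u + v) powr p \<le> ((a + b) / a) powr (p - 1) * u powr p + ((a + b) / b) powr (p - 1) * v powr p"
proof -
  have pos: "1 \<le> ((a + b) / a) powr (p - 1)" "1 \<le> ((a + b) / b) powr (p - 1)"
    using assms by (auto intro!: ge_one_powr_ge_zero simp: field_simps)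
  consider "u = 0" | "v = 0" | "0 < u" "0 < v" using assms by linarith
  then show ?thesis
  proof cases
    case 1
    then show ?thesis using pos mult_right_mono[OF pos(2), of "v powr p"] by simp
  next
    case 2
    then show ?thesis using pos mult_right_mono[OF pos(1), of "u powr p"] by simp
  next
    case 3
    define t where "t = b / (a + b)"
    have t: "0 \<le> t" "t \<le> 1" "1 - t = a / (a + b)"
      using assms by (auto simp: t_def field_simps)
    have *: "((1 - t) *\<^sub>R (u * (a+b)/a) + t *\<^sub>R (v * (a+b)/b)) powr p
        \<le> (1 - t) * (u * (a+b)/a) powr p + t * (v * (a+b)/b) powr p"
      using assms 3 t by (intro convex_onD[OF powr_convex[of p]]) auto
    have 1: "(1 - t) *\<^sub>R (u * (a+b)/a) + t *\<^sub>R (v * (a+b)/b) = u + v"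
      using assms by (simp add: t(3)) (simp add: t_def)
    have 2: "(1 - t) * (u * (a+b)/a) powr p = ((a + b) / a) powr (p - 1) * u powr p"
      using assms by (simp add: t(3) powr_weight_eq)
    have 3: "t * (v * (a+b)/b) powr p = ((a + b) / b) powr (p - 1) * v powr p"
      using assms by (simp add: t_def powr_weight_eq)
    show ?thesis using * unfolding 1 2 3 .
  qed
qed

text \<open>
  Minkowski's inequality for positive upper bounds of the norms, so that the weights are defined
  even when one of the norms is zero.
\<close>

lemma Lp_add_aux:
  assumes f: "f \<in> Lp_space p \<Omega>" and g: "g \<in> Lp_space p \<Omega>" and p: "1 \<le> p"
    and a: "0 < a" "Lp_norm p \<Omega> f \<le> a" and b: "0 < b" "Lp_norm p \<Omega> g \<le> b"
  shows "(\<lambda>x. f x + g x) \<in> Lp_space p \<Omega>" "Lp_norm p \<Omega> (\<lambda>x. f x + g x) \<le> a + b"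
proof -
  note [measurable] = Lp_measurable[OF f] Lp_measurable[OF g]
  define A where "A = ((a + b) / a) powr (p - 1)"
  define B where "B = ((a + b) / b) powr (p - 1)"
  have nn: "0 \<le> A" "0 \<le> B" by (auto simp: A_def B_def)
  have "(\<integral>\<^sup>+x. ennreal (norm (f x + g x) powr p) \<partial>lebesgue_on \<Omega>)
      \<le> (\<integral>\<^sup>+x. ennreal A * ennreal (norm (f x) powr p) + ennreal B * ennreal (norm (g x) powr p) \<partial>lebesgue_on \<Omega>)"
  proof (rule nn_integral_mono)
    fix x
    have "norm (f x + g x) powr p \<le> (norm (f x) + norm (g x)) powr p"
      using p by (intro powr_mono2 norm_triangle_ineq) auto
    also have "\<dots> \<le> A * norm (f x) powr p + B * norm (g x) powr p"
      unfolding A_def B_def using a b p by (intro powr_add_le_weighted) auto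
    finally show "ennreal (norm (f x + g x) powr p)
       \<le> ennreal A * ennreal (norm (f x) powr p) + ennreal B * ennreal (norm (g x) powr p)"
      using nn by (simp add: ennreal_mult'[symmetric] ennreal_plus[symmetric] ennreal_leI del: ennreal_plus)
  qed
  also have "\<dots> = ennreal A * ennreal (Lp_norm p \<Omega> f powr p) + ennreal B * ennreal (Lp_norm p \<Omega> g powr p)"
    using f g p by (subst nn_integral_add) (auto simp: nn_integral_cmult Lp_nn_integral)
  also have "\<dots> \<le> ennreal A * ennreal (a powr p) + ennreal B * ennreal (b powr p)"
    using a b p by (intro add_mono mult_left_mono ennreal_leI powr_mono2) auto
  also have "\<dots> = ennreal (A * a powr p + B * b powr p)"
    using nn by (simp add: ennreal_mult')
  also have "A * a powr p + B * b powr p = (a + b) powr p"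
  proof -
    have "A * a powr p = (a+b) powr p * (a / (a + b))" "B * b powr p = (a+b) powr p * (b / (a + b))"
      using a b powr_weight_eq[of a "a + b" a p] powr_weight_eq[of b "a + b" b p]
      by (auto simp: A_def B_def)
    then have "A * a powr p + B * b powr p = (a+b) powr p * (a / (a + b) + b / (a + b))"
      by (simp only: distrib_left)
    also have "a / (a + b) + b / (a + b) = 1"
      using a b by (simp add: add_divide_distrib[symmetric])
    finally show ?thesis by simp
  qed
  finally have le: "(\<integral>\<^sup>+x. ennreal (norm (f x + g x) powr p) \<partial>lebesgue_on \<Omega>) \<le> ennreal ((a + b) powr p)" .
  show "(\<lambda>x. f x + g x) \<in> Lp_space p \<Omega>" "Lp_norm p \<Omega> (\<lambda>x. f x + g x) \<le> a + b"
    using Lp_normI[OF _ _ _ le] a b p by auto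
qed

lemma Lp_add:
  assumes "f \<in> Lp_space p \<Omega>" "g \<in> Lp_space p \<Omega>" "1 \<le> p"
  shows "(\<lambda>x. f x + g x) \<in> Lp_space p \<Omega>"
  using Lp_add_aux(1)[OF assms, of "Lp_norm p \<Omega> f + 1" "Lp_norm p \<Omega> g + 1"]
  by (simp add: add_nonneg_pos)

lemma Lp_norm_triangle:
  assumes "f \<in> Lp_space p \<Omega>" "g \<in> Lp_space p \<Omega>" "1 \<le> p"
  shows "Lp_norm p \<Omega> (\<lambda>x. f x + g x) \<le> Lp_norm p \<Omega> f + Lp_norm p \<Omega> g"
proof (rule field_le_epsilon)
  fix e :: real assume "0 < e"
  then show "Lp_norm p \<Omega> (\<lambda>x. f x + g x) \<le> Lp_norm p \<Omega> f + Lp_norm p \<Omega> g + e"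
    using Lp_add_aux(2)[OF assms, of "Lp_norm p \<Omega> f + e/2" "Lp_norm p \<Omega> g + e/2"]
    by (simp add: add_nonneg_pos algebra_simps)
qed

lemma Lp_scale:
  assumes f: "f \<in> Lp_space p \<Omega>"
  shows "(\<lambda>x. c * f x) \<in> Lp_space p \<Omega>"
  using f by (auto simp: Lp_space_def norm_mult powr_mult)

lemma Lp_norm_scale:
  assumes p: "0 < p"
  shows "Lp_norm p \<Omega> (\<lambda>x. c * f x) = norm c * Lp_norm p \<Omega> f"
  using p by (simp add: Lp_norm_def norm_mult powr_mult powr_powr)

lemma Lp_diff:
  assumes "f \<in> Lp_space p \<Omega>" "g \<in> Lp_space p \<Omega>" "1 \<le> p"
  shows "(\<lambda>x. f x - g x) \<in> Lp_space p \<Omega>"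
    "Lp_norm p \<Omega> (\<lambda>x. f x - g x) \<le> Lp_norm p \<Omega> f + Lp_norm p \<Omega> g"
  using Lp_add[OF assms(1) Lp_scale[OF assms(2), of "-1"] assms(3)]
        Lp_norm_triangle[OF assms(1) Lp_scale[OF assms(2), of "-1"] assms(3)] assms(3)
        Lp_norm_scale[of p \<Omega> "-1" g]
  by auto

lemma Lp_zero: "(\<lambda>x. 0) \<in> Lp_space p \<Omega>" and Lp_norm_zero [simp]: "Lp_norm p \<Omega> (\<lambda>x. 0) = 0"
  by (auto simp: Lp_space_def Lp_norm_def)

lemma Lp_sum:
  assumes "finite A" "\<And>i. i \<in> A \<Longrightarrow> f i \<in> Lp_space p \<Omega>" "1 \<le> p"
  shows "(\<lambda>x. \<Sum>i\<in>A. f i x) \<in> Lp_space p \<Omega>"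
  using assms by (induction A rule: finite_induct) (auto simp: Lp_zero intro!: Lp_add)

lemma Lp_norm_sum_le:
  assumes "finite A" "\<And>i. i \<in> A \<Longrightarrow> f i \<in> Lp_space p \<Omega>" "1 \<le> p"
  shows "Lp_norm p \<Omega> (\<lambda>x. \<Sum>i\<in>A. f i x) \<le> (\<Sum>i\<in>A. Lp_norm p \<Omega> (f i))"
  using assms
proof (induction A rule: finite_induct)
  case (insert i A)
  have "Lp_norm p \<Omega> (\<lambda>x. f i x + (\<Sum>i\<in>A. f i x)) \<le> Lp_norm p \<Omega> (f i) + Lp_norm p \<Omega> (\<lambda>x. \<Sum>i\<in>A. f i x)"
    using insert by (intro Lp_norm_triangle Lp_sum) auto
  also have "\<dots> \<le> Lp_norm p \<Omega> (f i) + (\<Sum>i\<in>A. Lp_norm p \<Omega> (f i))"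
    using insert by auto
  finally show ?case using insert by simp
qed auto

text \<open>
  Hoelder's inequality against a function that is bounded by one and lives on a set \<open>D\<close>: the dual norm of such a function is at most \<open>measure D powr (1 - 1 / p)\<close>. As usual, Young's inequality
  for normalised factors is integrated; positive upper bounds \<open>a\<close> and \<open>b\<close> of the two norms, which tend to
  the norms at the end, make the normalisation harmless.
\<close>

lemma Lp_Holder_bounded:
  assumes f: "f \<in> Lp_space p \<Omega>" and p: "1 < p"
    and h[measurable]: "h \<in> borel_measurable (lebesgue_on \<Omega>)"
    and D: "D \<in> sets (lebesgue_on \<Omega>)" "emeasure (lebesgue_on \<Omega>) D < \<infinity>"
    and hD: "\<And>x. norm (h x) \<le> indicator D x"
  shows "integrable (lebesgue_on \<Omega>) (\<lambda>x. f x * h x)"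
    and "norm (\<integral>x. f x * h x \<partial>lebesgue_on \<Omega>)
           \<le> Lp_norm p \<Omega> f * measure (lebesgue_on \<Omega>) D powr (1 - 1 / p)"
proof -
  let ?M = "lebesgue_on \<Omega>"
  note [measurable] = Lp_measurable[OF f]
  define q where "q = p / (p - 1)"
  have q: "1 < q" "1 / p + 1 / q = 1" "1 - 1/p = 1/q"
    using p by (auto simp: q_def field_simps)
  have fi: "integrable ?M (\<lambda>x. norm (f x) powr p)"
    using f by (simp add: Lp_space_def)
  have Di: "integrable ?M (indicator D :: _ \<Rightarrow> real)"
    using D by simp
  have key: "norm (f x * h x) \<le> a * b powr (1/q) * (norm (f x) powr p / (p * a powr p) + indicator D x / (q * b))"
    if ab: "0 < a" "0 < b" for a b x
  proof (cases "x \<in> D")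
    case True
    have "norm (f x * h x) \<le> norm (f x)"
      using hD[of x] True by (simp add: norm_mult mult_left_le)
    also have "\<dots> = a * b powr (1/q) * ((norm (f x) / a) * (1 / b powr (1/q)))"
      using ab by simp
    also have "\<dots> \<le> a * b powr (1/q) * ((norm (f x) / a) powr p / p + (1 / b powr (1/q)) powr q / q)"
      using ab p q by (intro mult_left_mono Youngs_inequality) auto
    also have "(1 / b powr (1/q)) powr q = 1 / b"
      using ab q by (simp add: powr_divide powr_powr)
    also have "(norm (f x) / a) powr p / p = norm (f x) powr p / (p * a powr p)"
      using ab by (simp add: powr_divide)
    finally show ?thesis using True by (simp add: mult.commute)
  next
    case False
    then have "h x = 0" using hD[of x] by simp
    then show ?thesis using ab p q False by simp
  qed
  have dom: "integrable ?M (\<lambda>x. a * b powr (1/q) * (norm (f x) powr p / (p * a powr p) + indicator D x / (q * b)))" for a b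
    using fi Di by (intro integrable_mult_right integrable_add integrable_divide_zero) auto
  show int: "integrable ?M (\<lambda>x. f x * h x)"
  proof (rule Bochner_Integration.integrable_bound[OF dom[of 1 1]])
    show "AE x in ?M. norm (f x * h x) \<le> norm (1 * 1 powr (1/q) * (norm (f x) powr p / (p * 1 powr p) + indicator D x / (q * 1)))"
    proof (rule AE_I2)
      fix x show "norm (f x * h x) \<le> norm (1 * 1 powr (1/q) * (norm (f x) powr p / (p * 1 powr p) + indicator D x / (q * 1)))"
        using order_trans[OF key[of 1 1 x] abs_ge_self] by simp
    qed
    show "(\<lambda>x. f x * h x) \<in> borel_measurable ?M" by measurable
  qed
  have bound: "norm (\<integral>x. f x * h x \<partial>?M) \<le> a * b powr (1/q)"
    if ab: "0 < a" "0 < b" and a: "Lp_norm p \<Omega> f \<le> a" and b: "measure ?M D \<le> b" for a b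
  proof -
    have "norm (\<integral>x. f x * h x \<partial>?M) \<le> (\<integral>x. norm (f x * h x) \<partial>?M)"
      by (rule integral_norm_bound)
    also have "\<dots> \<le> (\<integral>x. a * b powr (1/q) * (norm (f x) powr p / (p * a powr p) + indicator D x / (q * b)) \<partial>?M)"
      by (rule integral_mono[OF integrable_norm[OF int] dom key[OF ab]])
    also have "\<dots> = a * b powr (1/q) * ((\<integral>x. norm (f x) powr p \<partial>?M) / (p * a powr p) + measure ?M D / (q * b))"
      using fi Di sets.sets_into_space[OF D(1)] by (simp add: Int_absorb2)
    also have "(\<integral>x. norm (f x) powr p \<partial>?M) = Lp_norm p \<Omega> f powr p"
      using p by (simp add: Lp_norm_def powr_powr)
    also have "a * b powr (1/q) * (Lp_norm p \<Omega> f powr p / (p * a powr p) + measure ?M D / (q * b))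
        \<le> a * b powr (1/q) * (a powr p / (p * a powr p) + b / (q * b))"
      using ab p q a b by (intro mult_left_mono add_mono divide_right_mono powr_mono2) auto
    also have "a powr p / (p * a powr p) + b / (q * b) = 1"
      using ab p q by simp
    finally show ?thesis by simp
  qed
  define a where "a n = Lp_norm p \<Omega> f + inverse (real (Suc n))" for n
  define b where "b n = measure ?M D + inverse (real (Suc n))" for n
  have lim: "a \<longlonglongrightarrow> Lp_norm p \<Omega> f" "b \<longlonglongrightarrow> measure ?M D"
    unfolding a_def b_def by (rule LIMSEQ_inverse_real_of_nat_add)+
  have "(\<lambda>n. a n * b n powr (1/q)) \<longlonglongrightarrow> Lp_norm p \<Omega> f * measure ?M D powr (1/q)"
    using q lim(1) tendsto_powr'[OF lim(2) tendsto_const[of "1/q"]]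
    by (intro tendsto_mult) (auto simp: b_def intro!: always_eventually)
  then show "norm (\<integral>x. f x * h x \<partial>?M) \<le> Lp_norm p \<Omega> f * measure ?M D powr (1 - 1 / p)"
    unfolding q(3)
    by (rule LIMSEQ_le_const) (auto intro!: exI[of _ 0] bound simp: a_def b_def add_nonneg_pos)
qed

section \<open>Completeness and uniform boundedness\<close>

text \<open>
  Completeness in the quantitative form that uniform boundedness needs. As in the Riesz--Fischer theorem, the
  sum of the moduli of the increments has a finite \<open>p\<close>-th moment by monotone convergence, so the sequence
  converges almost everywhere, and Fatou's lemma bounds the distance to the limit.
\<close>

lemma Lp_complete:
  assumes x: "\<And>k. x k \<in> Lp_space p \<Omega>" and p: "1 \<le> p"
    and d: "summable d" and step: "\<And>k. Lp_norm p \<Omega> (\<lambda>w. x (Suc k) w - x k w) \<le> d k"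
  obtains y where "y \<in> Lp_space p \<Omega>" "\<And>k. Lp_norm p \<Omega> (\<lambda>w. y w - x k w) \<le> (\<Sum>j. d (k + j))"
proof -
  let ?M = "lebesgue_on \<Omega>"
  have xm[measurable]: "x k \<in> borel_measurable ?M" for k using Lp_measurable[OF x] .
  have dn: "0 \<le> d k" for k
    using order_trans[OF Lp_norm_nonneg step] .
  have sd: "summable (\<lambda>j. d (k + j))" for k
    using summable_iff_shift[of d k] d by (simp add: add.commute)
  define c where "c j w = x (Suc j) w - x j w" for j w
  have cm[measurable]: "c j \<in> borel_measurable ?M" for j unfolding c_def by measurable
  have cL: "c j \<in> Lp_space p \<Omega>" for j
    unfolding c_def using x p by (intro Lp_diff(1)) auto
  define G where "G n w = (\<Sum>j<n. norm (c j w))" for n w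
  have Gm[measurable]: "G n \<in> borel_measurable ?M" for n unfolding G_def by measurable
  have Gn: "0 \<le> G n w" for n w unfolding G_def by (intro sum_nonneg) auto
  have Gint: "(\<integral>\<^sup>+w. ennreal (G n w powr p) \<partial>?M) \<le> ennreal (suminf d powr p)" for n
  proof -
    let ?h = "\<lambda>w. \<Sum>j<n. complex_of_real (norm (c j w))"
    have nL: "(\<lambda>w. complex_of_real (norm (c j w))) \<in> Lp_space p \<Omega>" for j
      using cL[of j] by (auto simp: Lp_space_def)
    have nn: "Lp_norm p \<Omega> (\<lambda>w. complex_of_real (norm (c j w))) \<le> d j" for j
      using step[of j] by (simp add: Lp_norm_def c_def)
    have hL: "?h \<in> Lp_space p \<Omega>" using nL p by (intro Lp_sum) auto
    have "Lp_norm p \<Omega> ?h \<le> (\<Sum>j<n. Lp_norm p \<Omega> (\<lambda>w. complex_of_real (norm (c j w))))"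
      using nL p by (intro Lp_norm_sum_le) auto
    also have "\<dots> \<le> (\<Sum>j<n. d j)" by (intro sum_mono nn)
    also have "\<dots> \<le> suminf d" using d dn by (intro sum_le_suminf) auto
    finally have "Lp_norm p \<Omega> ?h powr p \<le> suminf d powr p"
      using p by (intro powr_mono2) auto
    moreover have "norm (?h w) = G n w" for w
      using Gn[of n w] by (simp add: G_def flip: of_real_sum)
    ultimately show ?thesis
      using Lp_nn_integral[OF hL] p by (simp add: ennreal_leI)
  qed
  have "(\<integral>\<^sup>+w. (SUP n. ennreal (G n w powr p)) \<partial>?M) = (SUP n. \<integral>\<^sup>+w. ennreal (G n w powr p) \<partial>?M)"
  proof (rule nn_integral_monotone_convergence_SUP)
    show "incseq (\<lambda>n w. ennreal (G n w powr p))"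
      using p Gn by (intro incseq_SucI le_funI ennreal_leI powr_mono2) (auto simp: G_def)
  qed measurable
  also have "\<dots> \<le> ennreal (suminf d powr p)"
    using Gint by (intro SUP_least) auto
  finally have "(\<integral>\<^sup>+w. (SUP n. ennreal (G n w powr p)) \<partial>?M) \<noteq> \<infinity>"
    by (auto simp: top_unique)
  then have "AE w in ?M. (SUP n. ennreal (G n w powr p)) \<noteq> \<infinity>"
    by (intro nn_integral_PInf_AE) auto
  then have conv: "AE w in ?M. convergent (\<lambda>k. x k w)"
  proof (eventually_elim)
    case (elim w)
    then obtain r where r: "0 \<le> r" "(SUP n. ennreal (G n w powr p)) = ennreal r"
      by (cases "SUP n. ennreal (G n w powr p)") auto
    have "G n w \<le> r powr (1/p)" for n
    proof -
      have "ennreal (G n w powr p) \<le> ennreal r"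
        unfolding r(2)[symmetric] by (rule SUP_upper) auto
      then have "G n w powr p \<le> r" using r(1) by simp
      then have "(G n w powr p) powr (1/p) \<le> r powr (1/p)"
        using p by (intro powr_mono2) auto
      then show ?thesis using p Gn[of n w] by (simp add: powr_powr)
    qed
    then have "summable (\<lambda>j. norm (c j w))"
      unfolding G_def by (intro summableI_nonneg_bounded[of _ "r powr (1/p)"]) auto
    then have "summable (\<lambda>j. c j w)" by (rule summable_norm_cancel)
    then have "convergent (\<lambda>n. \<Sum>j<n. c j w)" by (simp add: summable_iff_convergent)
    moreover have "(\<Sum>j<n. c j w) = x n w - x 0 w" for n
      unfolding c_def by (rule sum_lessThan_telescope)
    ultimately have "convergent (\<lambda>n. x n w - x 0 w)" by simp
    then have "convergent (\<lambda>n. (x n w - x 0 w) + x 0 w)"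
      by (intro convergent_add convergent_const)
    then show ?case by simp
  qed
  define y where "y w = lim (\<lambda>k. x k w)" for w
  have ym[measurable]: "y \<in> borel_measurable ?M"
    unfolding y_def by (rule borel_measurable_lim_metric) (rule xm)
  have diff: "Lp_norm p \<Omega> (\<lambda>w. x (k + m) w - x k w) \<le> (\<Sum>j. d (k + j))" for k m
  proof -
    have "(\<lambda>w. x (k + m) w - x k w) = (\<lambda>w. \<Sum>j<m. c (k + j) w)"
      using sum_lessThan_telescope[of "\<lambda>j. x (k + j) _"] unfolding c_def by (simp add: fun_eq_iff)
    then have "Lp_norm p \<Omega> (\<lambda>w. x (k + m) w - x k w) \<le> (\<Sum>j<m. Lp_norm p \<Omega> (c (k + j)))"
      using Lp_norm_sum_le[of "{..<m}" "\<lambda>j. c (k + j)" p \<Omega>] cL p by simp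
    also have "\<dots> \<le> (\<Sum>j<m. d (k + j))"
      using step by (intro sum_mono) (simp add: c_def[abs_def])
    also have "\<dots> \<le> (\<Sum>j. d (k + j))" using sd dn by (intro sum_le_suminf) auto
    finally show ?thesis .
  qed
  have S0: "0 \<le> (\<Sum>j. d (k + j))" for k using sd dn by (intro suminf_nonneg) auto
  have le: "(\<integral>\<^sup>+w. ennreal (norm (y w - x k w) powr p) \<partial>?M) \<le> ennreal ((\<Sum>j. d (k + j)) powr p)" for k
  proof -
    let ?r = "\<lambda>m w. ennreal (norm (x (k + m) w - x k w) powr p)"
    have "(\<integral>\<^sup>+w. ennreal (norm (y w - x k w) powr p) \<partial>?M) = (\<integral>\<^sup>+w. liminf (\<lambda>m. ?r m w) \<partial>?M)"
    proof (rule nn_integral_cong_AE, use conv in eventually_elim)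
      case (elim w)
      then have "(\<lambda>k. x k w) \<longlonglongrightarrow> y w" unfolding y_def by (simp add: convergent_LIMSEQ_iff)
      then have "(\<lambda>m. x (k + m) w) \<longlonglongrightarrow> y w"
        using LIMSEQ_ignore_initial_segment[of "\<lambda>k. x k w" "y w" k] by (simp add: add.commute)
      then have "(\<lambda>m. ?r m w) \<longlonglongrightarrow> ennreal (norm (y w - x k w) powr p)"
        using p by (intro tendsto_ennrealI tendsto_powr' tendsto_norm tendsto_diff tendsto_const) auto
      then show ?case by (intro lim_imp_Liminf[symmetric]) auto
    qed
    also have "\<dots> \<le> liminf (\<lambda>m. \<integral>\<^sup>+w. ?r m w \<partial>?M)"
      by (rule nn_integral_liminf) measurable
    also have "\<dots> \<le> liminf (\<lambda>m. ennreal ((\<Sum>j. d (k + j)) powr p))"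
    proof (rule Liminf_mono, rule always_eventually, rule allI)
      fix m
      have "(\<lambda>w. x (k + m) w - x k w) \<in> Lp_space p \<Omega>" using x p by (intro Lp_diff(1)) auto
      then show "(\<integral>\<^sup>+w. ?r m w \<partial>?M) \<le> ennreal ((\<Sum>j. d (k + j)) powr p)"
        using diff[where k=k and m=m] p by (subst Lp_nn_integral) (auto intro!: ennreal_leI powr_mono2)
    qed
    finally show ?thesis by (simp add: Liminf_const)
  qed
  have yL: "(\<lambda>w. y w - x k w) \<in> Lp_space p \<Omega>" "Lp_norm p \<Omega> (\<lambda>w. y w - x k w) \<le> (\<Sum>j. d (k + j))" for k
    using Lp_normI[OF _ _ S0 le] p by auto
  have "(\<lambda>w. (y w - x 0 w) + x 0 w) \<in> Lp_space p \<Omega>"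
    by (rule Lp_add[OF yL(1) x p])
  then have "y \<in> Lp_space p \<Omega>" by simp
  then show ?thesis using that yL(2) by blast
qed

text \<open>
  The principle of uniform boundedness, proved by Sokal's argument, which avoids Baire's theorem: if
  the seminorms \<open>N i\<close> have unbounded operator norms, a series \<open>\<Sum>\<^sub>k \<plusminus> 3\<^sup>-\<^sup>k z\<^sub>k\<close> of nearly norming vectors is
  built whose sum has unbounded seminorms. At each step one of the two signs makes the seminorm of the partial sum
  at least that of the new term, because \<open>2 s z = (x + s z) - (x - s z)\<close>.
\<close>

theorem Lp_uniform_boundedness:
  fixes N :: "'i \<Rightarrow> ('a::euclidean_space \<Rightarrow> complex) \<Rightarrow> real"
  assumes p: "1 \<le> p"
    and add: "\<And>i f g. i \<in> I \<Longrightarrow> f \<in> Lp_space p \<Omega> \<Longrightarrow> g \<in> Lp_space p \<Omega> \<Longrightarrow> N i (\<lambda>x. f x + g x) \<le> N i f + N i g"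
    and scale: "\<And>i f c. i \<in> I \<Longrightarrow> f \<in> Lp_space p \<Omega> \<Longrightarrow> N i (\<lambda>x. c * f x) = norm c * N i f"
    and cont: "\<And>i. i \<in> I \<Longrightarrow> \<exists>C. \<forall>f\<in>Lp_space p \<Omega>. N i f \<le> C * Lp_norm p \<Omega> f"
    and bdd: "\<And>f. f \<in> Lp_space p \<Omega> \<Longrightarrow> \<exists>B. \<forall>i\<in>I. N i f \<le> B"
  shows "\<exists>C. \<forall>i\<in>I. \<forall>f\<in>Lp_space p \<Omega>. N i f \<le> C * Lp_norm p \<Omega> f"
proof (rule ccontr)
  assume no: "\<not> ?thesis"
  let ?L = "Lp_space p \<Omega>" and ?n = "Lp_norm p \<Omega>"
  have diffN: "N i f \<ge> N i g - N i (\<lambda>x. f x - g x)" if i: "i \<in> I" and f: "f \<in> ?L" and g: "g \<in> ?L" for i f g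
  proof -
    have fg: "(\<lambda>x. f x - g x) \<in> ?L" using f g p by (intro Lp_diff(1))
    have "N i (\<lambda>x. f x + (-1) * (f x - g x)) \<le> N i f + N i (\<lambda>x. (-1) * (f x - g x))"
      using add[OF i f Lp_scale[OF fg]] .
    moreover have "N i (\<lambda>x. (-1) * (f x - g x)) = N i (\<lambda>x. f x - g x)"
      using scale[OF i fg, of "-1"] by simp
    ultimately show ?thesis by simp
  qed
  \<comment> \<open>The number \<open>c\<close> is the operator norm of \<open>N i\<close>, and \<open>z\<close> attains two thirds of it.\<close>
  have "\<exists>i z c. i \<in> I \<and> z \<in> ?L \<and> ?n z \<le> 1 \<and> 4 ^ k \<le> c \<and> (\<forall>f\<in>?L. N i f \<le> c * ?n f) \<and> 2/3 * c \<le> N i z" for k :: nat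
  proof -
    obtain i f where i: "i \<in> I" and f: "f \<in> ?L" and big: "4 ^ k * ?n f < N i f"
      using no by (meson not_le)
    obtain C where C: "\<And>f. f \<in> ?L \<Longrightarrow> N i f \<le> C * ?n f" using cont[OF i] by blast
    have n0: "0 < ?n f"
      using C[OF f] big Lp_norm_nonneg[of p \<Omega> f] by (cases "?n f = 0") (auto simp: less_le)
    define c where "c = (SUP z\<in>{z\<in>?L. ?n z \<le> 1}. N i z)"
    have bd: "bdd_above (N i ` {z\<in>?L. ?n z \<le> 1})"
    proof (rule bdd_aboveI2)
      fix z assume "z \<in> {z\<in>?L. ?n z \<le> 1}"
      then have z: "N i z \<le> C * ?n z" "?n z \<le> 1" using C by auto
      moreover have "C * ?n z \<le> \<bar>C\<bar> * 1"
        using z(2) by (intro mult_mono) auto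
      ultimately show "N i z \<le> \<bar>C\<bar>" by linarith
    qed
    have up: "N i z \<le> c * ?n z" if z: "z \<in> ?L" for z
    proof (cases "?n z = 0")
      case True then show ?thesis using C[OF z] by simp
    next
      case False
      then have nz: "0 < ?n z" using Lp_norm_nonneg[of p \<Omega> z] by (simp add: less_le)
      let ?z = "\<lambda>x. complex_of_real (1 / ?n z) * z x"
      have "?n ?z = 1" using nz p by (subst Lp_norm_scale) (auto simp: norm_divide)
      then have "N i ?z \<le> c"
        unfolding c_def using Lp_scale[OF z, of "complex_of_real (1 / ?n z)"] by (intro cSUP_upper bd) simp
      moreover have "N i ?z = N i z / ?n z" using scale[OF i z, of "complex_of_real (1 / ?n z)"] nz by (simp add: norm_divide)
      ultimately have "N i z / ?n z \<le> c" by (simp only:)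
      then show ?thesis using nz by (simp add: pos_divide_le_eq)
    qed
    have c4: "4 ^ k \<le> c"
    proof -
      have "4 ^ k * ?n f \<le> c * ?n f" using up[OF f] big by simp
      then show ?thesis using n0 by simp
    qed
    have c0: "0 < c" by (rule less_le_trans[OF _ c4]) simp
    then have "2/3 * c < (SUP z\<in>{z\<in>?L. ?n z \<le> 1}. N i z)" by (simp add: c_def[symmetric])
    moreover have "(\<lambda>x. 0) \<in> {z\<in>?L. ?n z \<le> 1}" using Lp_zero by simp
    ultimately obtain z where "z \<in> ?L" "?n z \<le> 1" "2/3 * c < N i z"
      using less_cSUP_iff[OF _ bd, of "2/3 * c"] by blast
    then show ?thesis using i up c4 by (intro exI[of _ i] exI[of _ z] exI[of _ c]) auto
  qed
  then obtain i z c where i: "\<And>k::nat. i k \<in> I" and z: "\<And>k. z k \<in> ?L" "\<And>k. ?n (z k) \<le> 1"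
    and c: "\<And>k. 4 ^ k \<le> c k" "\<And>k f. f \<in> ?L \<Longrightarrow> N (i k) f \<le> c k * ?n f" "\<And>k. 2/3 * c k \<le> N (i k) (z k)"
    by metis
  define s where "s k = (1/3::real) ^ k" for k :: nat
  have s0: "0 < s k" for k by (simp add: s_def)
  have zL: "(\<lambda>w. complex_of_real e * z k w) \<in> ?L" for e k using z by (intro Lp_scale)
  have "\<exists>x. \<forall>k. x k \<in> ?L \<and> (x (Suc k) \<in> ?L \<and> ?n (\<lambda>w. x (Suc k) w - x k w) \<le> s k
        \<and> N (i k) (x (Suc k)) \<ge> s k * N (i k) (z k))"
  proof (rule dependent_nat_choice)
    show "\<exists>x. x \<in> ?L" using Lp_zero by blast
  next
    fix x k assume x: "x \<in> ?L"
    define u where "u e w = x w + complex_of_real (e * s k) * z k w" for e w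
    have uL: "u e \<in> ?L" for e
      unfolding u_def by (rule Lp_add[OF x zL p])
    have un: "?n (\<lambda>w. u e w - x w) \<le> \<bar>e\<bar> * s k" for e
    proof -
      have "?n (\<lambda>w. u e w - x w) = ?n (\<lambda>w. complex_of_real (e * s k) * z k w)"
        unfolding u_def by (simp only: add_diff_cancel_left')
      also have "\<dots> = norm (complex_of_real (e * s k)) * ?n (z k)"
        using p by (intro Lp_norm_scale) auto
      also have "\<dots> \<le> norm (complex_of_real (e * s k)) * 1"
        using z by (intro mult_left_mono) auto
      also have "\<dots> = \<bar>e\<bar> * s k"
        using s0[of k] by (simp only: norm_of_real abs_mult)
      finally show ?thesis .
    qed
    have "2 * (s k * N (i k) (z k)) = norm (complex_of_real (2 * s k)) * N (i k) (z k)"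
      using s0[of k] by (simp only: norm_of_real)
    also have "\<dots> = N (i k) (\<lambda>w. complex_of_real (2 * s k) * z k w)"
      using z i by (subst scale) auto
    also have "(\<lambda>w. complex_of_real (2 * s k) * z k w) = (\<lambda>w. u 1 w + (-1) * u (-1) w)"
      by (simp add: u_def fun_eq_iff algebra_simps)
    also have "N (i k) \<dots> \<le> N (i k) (u 1) + N (i k) (\<lambda>w. (-1) * u (-1) w)"
      by (rule add[OF i uL Lp_scale[OF uL]])
    also have "N (i k) (\<lambda>w. (-1) * u (-1) w) = N (i k) (u (-1))"
      using scale[OF i[of k] uL[of "-1"], of "-1"] by simp
    finally have "s k * N (i k) (z k) \<le> N (i k) (u 1) \<or> s k * N (i k) (z k) \<le> N (i k) (u (-1))"
      by linarith
    then show "\<exists>y. y \<in> ?L \<and> (y \<in> ?L \<and> ?n (\<lambda>w. y w - x w) \<le> s k \<and> N (i k) y \<ge> s k * N (i k) (z k))"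
      using uL un[of 1] un[of "-1"] by auto
  qed
  then obtain x where x: "\<And>k. x k \<in> ?L" "\<And>k. ?n (\<lambda>w. x (Suc k) w - x k w) \<le> s k"
    "\<And>k. N (i k) (x (Suc k)) \<ge> s k * N (i k) (z k)" by blast
  have geo: "s sums (3/2)" unfolding s_def using geometric_sums[of "1/3::real"] by simp
  \<comment> \<open>What follows step \<open>k\<close> changes the limit by at most half of \<open>s k\<close>; as \<open>1 / 2 < 2 / 3\<close>, it cannot undo the gain of that step.\<close>
  have tail: "(\<Sum>j. s (Suc k + j)) = s k / 2" for k
  proof -
    have "s (Suc k + j) = s (Suc k) * s j" for j unfolding s_def by (rule power_add)
    then have "(\<lambda>j. s (Suc k + j)) sums (s (Suc k) * (3/2))"
      using sums_mult[OF geo, of "s (Suc k)"] by simp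
    then have "(\<Sum>j. s (Suc k + j)) = s (Suc k) * (3/2)" by (rule sums_unique[symmetric])
    then show ?thesis by (simp add: s_def)
  qed
  obtain y where y: "y \<in> ?L" "\<And>k. ?n (\<lambda>w. y w - x k w) \<le> (\<Sum>j. s (k + j))"
    using Lp_complete[OF x(1) p sums_summable[OF geo] x(2)] by blast
  obtain B where B: "\<And>j. j \<in> I \<Longrightarrow> N j y \<le> B" using bdd[OF y(1)] by blast
  have "1/6 * (4/3) ^ k \<le> B" for k
  proof -
    have yx: "(\<lambda>w. y w - x (Suc k) w) \<in> ?L" using y x p by (intro Lp_diff(1)) auto
    have ck: "0 \<le> c k" using order_trans[OF _ c(1)[of k], of 0] by simp
    have "N (i k) (\<lambda>w. y w - x (Suc k) w) \<le> c k * ?n (\<lambda>w. y w - x (Suc k) w)"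
      by (rule c(2)[OF yx])
    also have "\<dots> \<le> c k * (s k / 2)"
      using y(2)[of "Suc k"] ck unfolding tail by (intro mult_left_mono) auto
    finally have 1: "N (i k) (\<lambda>w. y w - x (Suc k) w) \<le> c k * (s k / 2)" .
    have "s k * (2/3 * c k) \<le> s k * N (i k) (z k)"
      using c(3) s0[of k] by (intro mult_left_mono) auto
    then have "s k * (2/3 * c k) \<le> N (i k) (x (Suc k))" using x(3)[of k] by simp
    then have "1/6 * (s k * c k) \<le> N (i k) y"
      using diffN[OF i[of k] y(1) x(1)[of "Suc k"]] 1 by (simp add: algebra_simps)
    moreover have "s k * 4 ^ k \<le> s k * c k" using c(1) s0[of k] by (intro mult_left_mono) auto
    moreover have "s k * 4 ^ k = (4/3) ^ k" by (simp add: s_def power_divide)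
    ultimately show ?thesis using B[OF i[of k]] by simp
  qed
  moreover obtain k where "6 * B < (4/3::real) ^ k" using real_arch_pow[of "4/3" "6 * B"] by auto
  ultimately show False by (simp add: mult.commute not_le[symmetric])
qed

section \<open>Unconditional convergence and frames\<close>

text \<open>
  Here \<open>G F\<close> stands for the norm of the partial sum over \<open>F\<close>. If finite partial sums are unbounded, they
  are unbounded even among the sets containing a prescribed finite set. So there is a growing chain of
  finite sets, exhausting \<open>I\<close>, along which they tend to infinity, and an enumeration that runs through these
  sets one after the other is a rearrangement with unbounded partial sums. The chain is kept as a chain
  of lists, each a prefix of the next, from which the enumeration is read off.
\<close>

lemma bounded_finite_sums_of_rearrangements:
  fixes G :: "'i set \<Rightarrow> real"
  assumes cI: "countable I" and iI: "infinite I"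
    and sub: "\<And>F A. finite F \<Longrightarrow> finite A \<Longrightarrow> F \<subseteq> I \<Longrightarrow> A \<subseteq> I \<Longrightarrow> F \<inter> A = {} \<Longrightarrow> G F \<le> G (F \<union> A) + G A"
    and bdd: "\<And>\<sigma>::nat \<Rightarrow> 'i. bij_betw \<sigma> UNIV I \<Longrightarrow> \<exists>B. \<forall>n. G (\<sigma> ` {..<n}) \<le> B"
  shows "\<exists>B. \<forall>F. finite F \<and> F \<subseteq> I \<longrightarrow> G F \<le> B"
proof (rule ccontr)
  assume no: "\<not> ?thesis"
  have ext: "\<exists>F. finite F \<and> F \<subseteq> I \<and> A \<subseteq> F \<and> B < G F" if A: "finite A" "A \<subseteq> I" for A B
  proof -
    have fin: "finite (G ` Pow A)" using A by simp
    obtain F where F: "finite F" "F \<subseteq> I" "B + Max (G ` Pow A) < G F"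
      using no by (meson not_le)
    have "G F \<le> G (F \<union> (A - F)) + G (A - F)"
      using A F by (intro sub) auto
    moreover have "G (A - F) \<le> Max (G ` Pow A)"
      using fin by (intro Max_ge) auto
    ultimately have "B < G (F \<union> (A - F))" using F(3) by linarith
    then show ?thesis using A F by (intro exI[of _ "F \<union> (A - F)"]) auto
  qed
  define \<tau> where "\<tau> = from_nat_into I"
  have \<tau>: "bij_betw \<tau> UNIV I" unfolding \<tau>_def using bij_betw_from_nat_into[OF cI iI] .
  have "\<exists>l. \<forall>n. (distinct (l n) \<and> set (l n) \<subseteq> I \<and> n \<le> length (l n)) \<and>
      ((\<exists>e. l (Suc n) = l n @ e) \<and> real n < G (set (l (Suc n))) \<and> \<tau> n \<in> set (l (Suc n)))"
  proof (rule dependent_nat_choice)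
    show "\<exists>x. distinct x \<and> set x \<subseteq> I \<and> 0 \<le> length x" by (intro exI[of _ "[]"]) simp
  next
    fix x :: "'i list" and n :: nat
    assume x: "distinct x \<and> set x \<subseteq> I \<and> n \<le> length x"
    obtain a where a: "a \<in> I" "a \<notin> set x"
      using iI by (meson List.finite_set finite_subset subsetI)
    have "\<tau> n \<in> I" using \<tau> by (auto simp: bij_betw_def)
    then obtain F where F: "finite F" "F \<subseteq> I" "insert (\<tau> n) (insert a (set x)) \<subseteq> F" "real n < G F"
      using ext[of "insert (\<tau> n) (insert a (set x))" "real n"] x a by auto
    obtain e where e: "set e = F - set x" "distinct e"
      using finite_distinct_list[of "F - set x"] F by auto
    have "e \<noteq> []" using e(1) a F by auto
    then have "Suc n \<le> length (x @ e)" using x by (cases e) auto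
    moreover have "set (x @ e) = F" using e F by auto
    ultimately show "\<exists>y. (distinct y \<and> set y \<subseteq> I \<and> Suc n \<le> length y) \<and>
        ((\<exists>e. y = x @ e) \<and> real n < G (set y) \<and> \<tau> n \<in> set y)"
      using e x F by (intro exI[of _ "x @ e"]) auto
  qed
  then obtain l where l: "\<And>n. distinct (l n)" "\<And>n. set (l n) \<subseteq> I" "\<And>n::nat. n \<le> length (l n)"
    "\<And>n. \<exists>e. l (Suc n) = l n @ e" "\<And>n. real n < G (set (l (Suc n)))" "\<And>n. \<tau> n \<in> set (l (Suc n))"
    by blast
  have prefix: "\<exists>e. l m = l n @ e" if "n \<le> m" for n m
    using that
  proof (induction m rule: dec_induct)
    case (step m)
    then show ?case using l(4)[of m] by auto
  qed simp
  define \<sigma> where "\<sigma> n = l (Suc n) ! n" for n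
  have len: "n < length (l (Suc n))" for n using l(3)[of "Suc n"] by simp
  have nth: "l m ! n = \<sigma> n" if "n < length (l m)" for n m
  proof (cases "Suc n \<le> m")
    case True
    then show ?thesis using prefix[OF True] len[of n] by (auto simp: \<sigma>_def nth_append)
  next
    case False
    then have "m \<le> Suc n" by simp
    then show ?thesis using prefix[of m "Suc n"] that by (auto simp: \<sigma>_def nth_append)
  qed
  have img: "\<sigma> ` {..<length (l m)} = set (l m)" for m
    using nth[of _ m] by (auto simp: set_conv_nth image_iff Bex_def) metis
  have "bij_betw \<sigma> UNIV I"
    unfolding bij_betw_def
  proof
    show "inj \<sigma>"
    proof (rule injI)
      fix n n' assume eq: "\<sigma> n = \<sigma> n'"
      define m where "m = Suc (max n n')"
      have "n < length (l m)" "n' < length (l m)" using l(3)[of m] by (auto simp: m_def)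
      then show "n = n'" using eq nth[of n m] nth[of n' m] l(1)[of m]
        by (metis nth_eq_iff_index_eq)
    qed
    show "range \<sigma> = I"
    proof
      show "range \<sigma> \<subseteq> I"
        using l(2) len by (auto simp: \<sigma>_def dest!: nth_mem)
      show "I \<subseteq> range \<sigma>"
      proof
        fix x assume "x \<in> I"
        then obtain n where "x = \<tau> n" using \<tau> by (auto simp: bij_betw_def)
        then have "x \<in> set (l (Suc n))" using l(6) by simp
        then show "x \<in> range \<sigma>" using img[of "Suc n"] by blast
      qed
    qed
  qed
  then obtain B where B: "\<And>n. G (\<sigma> ` {..<n}) \<le> B" using bdd by blast
  obtain n where "B < real n" using reals_Archimedean2 by blast
  then have "B < G (set (l (Suc n)))" using l(5)[of n] by simp
  then show False using B[of "length (l (Suc n))"] img[of "Suc n"] by simp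
qed

text \<open>
  The factor \<open>4\<close> comes from treating positive and negative values of the real and imaginary parts separately.
\<close>

lemma sum_norm_le_of_partial_sums:
  fixes z :: "'i \<Rightarrow> complex"
  assumes F: "finite F" and B: "\<And>F'. F' \<subseteq> F \<Longrightarrow> norm (\<Sum>i\<in>F'. z i) \<le> B"
  shows "(\<Sum>i\<in>F. norm (z i)) \<le> 4 * B"
proof -
  have real: "(\<Sum>i\<in>F. \<bar>r i\<bar>) \<le> 2 * B" if r: "\<And>F'. F' \<subseteq> F \<Longrightarrow> \<bar>\<Sum>i\<in>F'. r i\<bar> \<le> B" for r :: "'i \<Rightarrow> real"
  proof -
    let ?P = "{i\<in>F. 0 \<le> r i}"
    have "(\<Sum>i\<in>F. \<bar>r i\<bar>) = (\<Sum>i\<in>?P. \<bar>r i\<bar>) + (\<Sum>i\<in>F - ?P. \<bar>r i\<bar>)"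
      using F by (subst sum.subset_diff[of ?P F]) auto
    also have "(\<Sum>i\<in>?P. \<bar>r i\<bar>) = (\<Sum>i\<in>?P. r i)" by (intro sum.cong) auto
    also have "(\<Sum>i\<in>F - ?P. \<bar>r i\<bar>) = - (\<Sum>i\<in>F - ?P. r i)"
      unfolding sum_negf[symmetric] by (intro sum.cong) auto
    finally show ?thesis using r[of ?P] r[of "F - ?P"] by auto
  qed
  have "(\<Sum>i\<in>F. norm (z i)) \<le> (\<Sum>i\<in>F. \<bar>Re (z i)\<bar> + \<bar>Im (z i)\<bar>)"
    by (intro sum_mono cmod_le)
  also have "\<dots> \<le> 2 * B + 2 * B"
    unfolding sum.distrib
  proof (intro add_mono real)
    fix F' assume "F' \<subseteq> F"
    then show "\<bar>\<Sum>i\<in>F'. Re (z i)\<bar> \<le> B" "\<bar>\<Sum>i\<in>F'. Im (z i)\<bar> \<le> B"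
      using B[of F'] abs_Re_le_cmod[of "\<Sum>i\<in>F'. z i"] abs_Im_le_cmod[of "\<Sum>i\<in>F'. z i"] by auto
  qed
  finally show ?thesis by simp
qed

text \<open>
  Uniform boundedness applied to the seminorms that send \<open>f\<close> to the norm of the partial sum over \<open>F\<close> of its
  frame expansion. They are bounded pointwise because otherwise some rearrangement of the expansion would
  diverge.
\<close>

lemma frame_partial_sums_bounded:
  fixes \<Omega> :: "'a::euclidean_space set"
  assumes fr: "unconditional_Schauder_frame p \<Omega> \<Lambda> u \<phi>" and p: "1 \<le> p"
  shows "\<exists>C. \<forall>F. finite F \<and> F \<subseteq> \<Lambda> \<longrightarrow> (\<forall>f\<in>Lp_space p \<Omega>.
    Lp_norm p \<Omega> (\<lambda>x. \<Sum>i\<in>F. \<phi> i f * u i x) \<le> C * Lp_norm p \<Omega> f)"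
proof -
  define N where "N F f = Lp_norm p \<Omega> (\<lambda>x. \<Sum>i\<in>F. \<phi> i f * u i x)" for F f
  have u: "u i \<in> Lp_space p \<Omega>" and \<phi>: "\<phi> i \<in> Lp_dual p \<Omega>" if "i \<in> \<Lambda>" for i
    using fr that by (auto simp: unconditional_Schauder_frame_def)
  have L: "(\<lambda>x. \<Sum>i\<in>F. \<phi> i f * u i x) \<in> Lp_space p \<Omega>" if "finite F" "F \<subseteq> \<Lambda>" for F f
    using that p u by (intro Lp_sum Lp_scale) auto
  have "\<exists>C. \<forall>F\<in>{F. finite F \<and> F \<subseteq> \<Lambda>}. \<forall>f\<in>Lp_space p \<Omega>. N F f \<le> C * Lp_norm p \<Omega> f"
  proof (rule Lp_uniform_boundedness)
    show "1 \<le> p" by (rule p)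
  next
    fix F f g assume F: "F \<in> {F. finite F \<and> F \<subseteq> \<Lambda>}" and f: "f \<in> Lp_space p \<Omega>" and g: "g \<in> Lp_space p \<Omega>"
    have "\<phi> i (\<lambda>x. f x + g x) = \<phi> i f + \<phi> i g" if "i \<in> F" for i
      using \<phi>[of i] F f g that by (auto simp: Lp_dual_def)
    then have "(\<lambda>x. \<Sum>i\<in>F. \<phi> i (\<lambda>x. f x + g x) * u i x)
        = (\<lambda>x. (\<Sum>i\<in>F. \<phi> i f * u i x) + (\<Sum>i\<in>F. \<phi> i g * u i x))"
      by (simp add: sum.distrib[symmetric] distrib_right)
    then show "N F (\<lambda>x. f x + g x) \<le> N F f + N F g"
      unfolding N_def using Lp_norm_triangle[OF L L p] F by simp
  next
    fix F f c assume F: "F \<in> {F. finite F \<and> F \<subseteq> \<Lambda>}" and f: "f \<in> Lp_space p \<Omega>"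
    have "\<phi> i (\<lambda>x. c * f x) = c * \<phi> i f" if "i \<in> F" for i
      using \<phi>[of i] F f that by (auto simp: Lp_dual_def)
    then have "(\<lambda>x. \<Sum>i\<in>F. \<phi> i (\<lambda>x. c * f x) * u i x) = (\<lambda>x. c * (\<Sum>i\<in>F. \<phi> i f * u i x))"
      by (simp add: sum_distrib_left mult.assoc)
    then show "N F (\<lambda>x. c * f x) = norm c * N F f"
      unfolding N_def using p by (simp add: Lp_norm_scale)
  next
    fix F assume F: "F \<in> {F. finite F \<and> F \<subseteq> \<Lambda>}"
    have "\<forall>i. \<exists>K. i \<in> \<Lambda> \<longrightarrow> (\<forall>f\<in>Lp_space p \<Omega>. norm (\<phi> i f) \<le> K * Lp_norm p \<Omega> f)"
      using \<phi> by (auto simp: Lp_dual_def)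
    then obtain K where K: "\<And>i f. i \<in> \<Lambda> \<Longrightarrow> f \<in> Lp_space p \<Omega> \<Longrightarrow> norm (\<phi> i f) \<le> K i * Lp_norm p \<Omega> f"
      by metis
    have "N F f \<le> (\<Sum>i\<in>F. K i * Lp_norm p \<Omega> (u i)) * Lp_norm p \<Omega> f" if f: "f \<in> Lp_space p \<Omega>" for f
    proof -
      have "N F f \<le> (\<Sum>i\<in>F. Lp_norm p \<Omega> (\<lambda>x. \<phi> i f * u i x))"
        unfolding N_def using F p u by (intro Lp_norm_sum_le Lp_scale) auto
      also have "\<dots> = (\<Sum>i\<in>F. norm (\<phi> i f) * Lp_norm p \<Omega> (u i))"
        using p by (simp add: Lp_norm_scale)
      also have "\<dots> \<le> (\<Sum>i\<in>F. (K i * Lp_norm p \<Omega> f) * Lp_norm p \<Omega> (u i))"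
        using F f K by (intro sum_mono mult_right_mono) auto
      also have "\<dots> = (\<Sum>i\<in>F. K i * Lp_norm p \<Omega> (u i)) * Lp_norm p \<Omega> f"
        unfolding sum_distrib_right by (intro sum.cong) auto
      finally show ?thesis .
    qed
    then show "\<exists>C. \<forall>f\<in>Lp_space p \<Omega>. N F f \<le> C * Lp_norm p \<Omega> f" by blast
  next
    fix f assume f: "f \<in> Lp_space p \<Omega>"
    have "\<exists>B. \<forall>F. finite F \<and> F \<subseteq> \<Lambda> \<longrightarrow> N F f \<le> B"
    proof (cases "finite \<Lambda>")
      case True
      then have "finite ((\<lambda>F. N F f) ` Pow \<Lambda>)" by simp
      then show ?thesis
        by (intro exI[of _ "Max ((\<lambda>F. N F f) ` Pow \<Lambda>)"]) auto
    next
      case False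
      show ?thesis
      proof (rule bounded_finite_sums_of_rearrangements)
        show "countable \<Lambda>" using fr by (simp add: unconditional_Schauder_frame_def)
        show "infinite \<Lambda>" by (rule False)
      next
        fix F A assume FA: "finite F" "finite A" "F \<subseteq> \<Lambda>" "A \<subseteq> \<Lambda>" "F \<inter> A = {}"
        have "(\<lambda>x. \<Sum>i\<in>F. \<phi> i f * u i x)
            = (\<lambda>x. (\<Sum>i\<in>F \<union> A. \<phi> i f * u i x) - (\<Sum>i\<in>A. \<phi> i f * u i x))"
          using FA by (simp add: sum.union_disjoint)
        then show "N F f \<le> N (F \<union> A) f + N A f"
          unfolding N_def using FA p by (simp only:) (intro Lp_diff(2) L; simp)
      next
        fix \<sigma> :: "nat \<Rightarrow> _" assume \<sigma>: "bij_betw \<sigma> UNIV \<Lambda>"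
        define S where "S n x = (\<Sum>k<n. \<phi> (\<sigma> k) f * u (\<sigma> k) x)" for n x
        have S: "S n = (\<lambda>x. \<Sum>i\<in>\<sigma> ` {..<n}. \<phi> i f * u i x)" for n
          using \<sigma> by (auto simp: S_def fun_eq_iff bij_betw_def intro!: sum.reindex_cong[symmetric] intro: inj_on_subset)
        have SL: "S n \<in> Lp_space p \<Omega>" for n
          unfolding S using \<sigma> by (intro L) (auto simp: bij_betw_def)
        have "(\<lambda>n. Lp_norm p \<Omega> (\<lambda>x. S n x - f x)) \<longlonglongrightarrow> 0"
          using fr f False \<sigma> by (auto simp: unconditional_Schauder_frame_def Lp_sums_unconditionally_def S_def)
        then have "Bseq (\<lambda>n. Lp_norm p \<Omega> (\<lambda>x. S n x - f x))"
          by (intro convergent_imp_Bseq convergentI)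
        then obtain B where B: "\<And>n. Lp_norm p \<Omega> (\<lambda>x. S n x - f x) \<le> B"
          by (auto simp: Bseq_def)
        have "N (\<sigma> ` {..<n}) f \<le> B + Lp_norm p \<Omega> f" for n
        proof -
          have "N (\<sigma> ` {..<n}) f = Lp_norm p \<Omega> (\<lambda>x. (S n x - f x) + f x)"
            unfolding N_def S[symmetric] by simp
          also have "\<dots> \<le> Lp_norm p \<Omega> (\<lambda>x. S n x - f x) + Lp_norm p \<Omega> f"
            using SL f p by (intro Lp_norm_triangle Lp_diff(1)) auto
          finally show ?thesis using B[of n] by simp
        qed
        then show "\<exists>B. \<forall>n. N (\<sigma> ` {..<n}) f \<le> B" by blast
      qed
    qed
    then show "\<exists>B. \<forall>F\<in>{F. finite F \<and> F \<subseteq> \<Lambda>}. N F f \<le> B" by auto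
  qed
  then show ?thesis unfolding N_def by blast
qed

text \<open>
  Partial sums over all subsets of \<open>F\<close> are bounded uniformly, so their pairings with \<open>h\<close> are, and a scalar
  sum with bounded subsums is bounded absolutely. The factor \<open>measure D powr (1 - 1 / p)\<close> takes the place
  of the dual norm of \<open>h\<close>.
\<close>

lemma frame_absolute_bound:
  fixes \<Omega> :: "'a::euclidean_space set"
  assumes fr: "unconditional_Schauder_frame p \<Omega> \<Lambda> u \<phi>" and p: "1 < p"
  obtains C where "\<And>F f (h :: 'a \<Rightarrow> complex) D. \<lbrakk>finite F; F \<subseteq> \<Lambda>; f \<in> Lp_space p \<Omega>; h \<in> borel_measurable (lebesgue_on \<Omega>);
      D \<in> sets (lebesgue_on \<Omega>); emeasure (lebesgue_on \<Omega>) D < \<infinity>; \<And>x. norm (h x) \<le> indicator D x\<rbrakk> \<Longrightarrow>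
    (\<Sum>i\<in>F. norm (\<phi> i f) * norm (\<integral>x. u i x * h x \<partial>lebesgue_on \<Omega>))
      \<le> C * Lp_norm p \<Omega> f * measure (lebesgue_on \<Omega>) D powr (1 - 1 / p)"
proof -
  have u: "u i \<in> Lp_space p \<Omega>" if "i \<in> \<Lambda>" for i
    using fr that by (auto simp: unconditional_Schauder_frame_def)
  obtain C where C: "\<And>F f. finite F \<Longrightarrow> F \<subseteq> \<Lambda> \<Longrightarrow> f \<in> Lp_space p \<Omega> \<Longrightarrow>
      Lp_norm p \<Omega> (\<lambda>x. \<Sum>i\<in>F. \<phi> i f * u i x) \<le> C * Lp_norm p \<Omega> f"
    using frame_partial_sums_bounded[OF fr] p by (metis less_imp_le)
  show ?thesis
  proof (rule that[of "4 * C"])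
    fix F f and h :: "'a \<Rightarrow> complex" and D
    assume F: "finite F" "F \<subseteq> \<Lambda>" and f: "f \<in> Lp_space p \<Omega>"
      and h: "h \<in> borel_measurable (lebesgue_on \<Omega>)"
         "D \<in> sets (lebesgue_on \<Omega>)" "emeasure (lebesgue_on \<Omega>) D < \<infinity>" "\<And>x. norm (h x) \<le> indicator D x"
    let ?z = "\<lambda>i. \<phi> i f * (\<integral>x. u i x * h x \<partial>lebesgue_on \<Omega>)"
    let ?m = "measure (lebesgue_on \<Omega>) D powr (1 - 1 / p)"
    have "(\<Sum>i\<in>F. norm (?z i)) \<le> 4 * (C * Lp_norm p \<Omega> f * ?m)"
    proof (rule sum_norm_le_of_partial_sums[OF F(1)])
      fix F' assume "F' \<subseteq> F"
      then have F': "finite F'" "F' \<subseteq> \<Lambda>" using F finite_subset by auto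
      have L: "(\<lambda>x. \<Sum>i\<in>F'. \<phi> i f * u i x) \<in> Lp_space p \<Omega>"
        using F' p u by (intro Lp_sum Lp_scale) auto
      have "(\<Sum>i\<in>F'. ?z i) = (\<Sum>i\<in>F'. \<integral>x. \<phi> i f * (u i x * h x) \<partial>lebesgue_on \<Omega>)"
        by simp
      also have "\<dots> = (\<integral>x. (\<Sum>i\<in>F'. \<phi> i f * (u i x * h x)) \<partial>lebesgue_on \<Omega>)"
        using F' u p h by (intro Bochner_Integration.integral_sum[symmetric] integrable_mult_right Lp_Holder_bounded(1)) auto
      also have "\<dots> = (\<integral>x. (\<Sum>i\<in>F'. \<phi> i f * u i x) * h x \<partial>lebesgue_on \<Omega>)"
        by (simp add: sum_distrib_right mult.assoc)
      finally have "norm (\<Sum>i\<in>F'. ?z i) \<le> Lp_norm p \<Omega> (\<lambda>x. \<Sum>i\<in>F'. \<phi> i f * u i x) * ?m"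
        using Lp_Holder_bounded(2)[OF L p h] by simp
      also have "\<dots> \<le> C * Lp_norm p \<Omega> f * ?m"
        using C[OF F' f] by (intro mult_right_mono) auto
      finally show "norm (\<Sum>i\<in>F'. ?z i) \<le> C * Lp_norm p \<Omega> f * ?m" .
    qed
    then show "(\<Sum>i\<in>F. norm (\<phi> i f) * norm (\<integral>x. u i x * h x \<partial>lebesgue_on \<Omega>))
      \<le> 4 * C * Lp_norm p \<Omega> f * ?m"
      by (simp add: norm_mult mult.assoc)
  qed
qed

text \<open>
  The companion of the preceding bound: the pairing of \<open>f\<close> with \<open>h\<close> is the limit of the pairings of the partial
  sums, and these are at most the absolute sums.
\<close>

lemma frame_pairing_le:
  fixes \<Omega> :: "'a::euclidean_space set"
  assumes fr: "unconditional_Schauder_frame p \<Omega> \<Lambda> u \<phi>" and p: "1 < p" and f: "f \<in> Lp_space p \<Omega>"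
    and h: "h \<in> borel_measurable (lebesgue_on \<Omega>)" "D \<in> sets (lebesgue_on \<Omega>)"
       "emeasure (lebesgue_on \<Omega>) D < \<infinity>" "\<And>x. norm (h x) \<le> indicator D x"
    and B: "\<And>F. finite F \<Longrightarrow> F \<subseteq> \<Lambda> \<Longrightarrow>
      (\<Sum>i\<in>F. norm (\<phi> i f) * norm (\<integral>x. u i x * h x \<partial>lebesgue_on \<Omega>)) \<le> B"
  shows "norm (\<integral>x. f x * h x \<partial>lebesgue_on \<Omega>) \<le> B"
proof -
  let ?M = "lebesgue_on \<Omega>"
  let ?m = "measure ?M D powr (1 - 1 / p)"
  have u: "u i \<in> Lp_space p \<Omega>" if "i \<in> \<Lambda>" for i
    using fr that by (auto simp: unconditional_Schauder_frame_def)
  have approx: "norm (\<integral>x. f x * h x \<partial>?M) \<le> B + Lp_norm p \<Omega> (\<lambda>x. (\<Sum>i\<in>F. \<phi> i f * u i x) - f x) * ?m"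
    if F: "finite F" "F \<subseteq> \<Lambda>" for F
  proof -
    define S where "S x = (\<Sum>i\<in>F. \<phi> i f * u i x)" for x
    have S: "S \<in> Lp_space p \<Omega>"
      unfolding S_def using F p u by (intro Lp_sum Lp_scale) auto
    have d: "(\<lambda>x. S x - f x) \<in> Lp_space p \<Omega>" using S f p by (intro Lp_diff(1)) auto
    note int = Lp_Holder_bounded(1)[OF _ p h]
    have "(\<integral>x. S x * h x \<partial>?M) = (\<integral>x. (\<Sum>i\<in>F. \<phi> i f * (u i x * h x)) \<partial>?M)"
      by (simp add: S_def sum_distrib_right mult.assoc)
    also have "\<dots> = (\<Sum>i\<in>F. \<integral>x. \<phi> i f * (u i x * h x) \<partial>?M)"
      using F u by (intro Bochner_Integration.integral_sum integrable_mult_right int) auto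
    finally have "norm (\<integral>x. S x * h x \<partial>?M) \<le> (\<Sum>i\<in>F. norm (\<phi> i f) * norm (\<integral>x. u i x * h x \<partial>?M))"
      using norm_sum[of "\<lambda>i. \<integral>x. \<phi> i f * (u i x * h x) \<partial>?M" F] by (simp add: norm_mult)
    then have 1: "norm (\<integral>x. S x * h x \<partial>?M) \<le> B" using B[OF F] by simp
    have "(\<integral>x. f x * h x \<partial>?M) = (\<integral>x. S x * h x - (S x - f x) * h x \<partial>?M)"
      by (simp add: algebra_simps)
    also have "\<dots> = (\<integral>x. S x * h x \<partial>?M) - (\<integral>x. (S x - f x) * h x \<partial>?M)"
      using int[OF S] int[OF d] by (rule Bochner_Integration.integral_diff)
    finally have "norm (\<integral>x. f x * h x \<partial>?M) \<le> norm (\<integral>x. S x * h x \<partial>?M) + norm (\<integral>x. (S x - f x) * h x \<partial>?M)"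
      by (simp add: norm_triangle_ineq4)
    also have "\<dots> \<le> B + Lp_norm p \<Omega> (\<lambda>x. S x - f x) * ?m"
      by (intro add_mono 1 Lp_Holder_bounded(2)[OF d p h])
    finally show ?thesis unfolding S_def .
  qed
  have sums: "Lp_sums_unconditionally p \<Omega> \<Lambda> (\<lambda>i x. \<phi> i f * u i x) f" and c: "countable \<Lambda>"
    using fr f by (auto simp: unconditional_Schauder_frame_def)
  show ?thesis
  proof (cases "finite \<Lambda>")
    case True
    then show ?thesis using approx[of \<Lambda>] sums by (simp add: Lp_sums_unconditionally_def)
  next
    case False
    define \<sigma> where "\<sigma> = from_nat_into \<Lambda>"
    have \<sigma>: "bij_betw \<sigma> UNIV \<Lambda>" unfolding \<sigma>_def using bij_betw_from_nat_into[OF c False] .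
    define d where "d n = Lp_norm p \<Omega> (\<lambda>x. (\<Sum>k<n. \<phi> (\<sigma> k) f * u (\<sigma> k) x) - f x)" for n
    have "d \<longlonglongrightarrow> 0"
      using sums False \<sigma> by (simp add: Lp_sums_unconditionally_def d_def[abs_def])
    then have lim: "(\<lambda>n. B + d n * ?m) \<longlonglongrightarrow> B + 0 * ?m"
      by (intro tendsto_intros)
    have "norm (\<integral>x. f x * h x \<partial>?M) \<le> B + d n * ?m" for n
    proof -
      have "(\<Sum>k<n. \<phi> (\<sigma> k) f * u (\<sigma> k) x) = (\<Sum>i\<in>\<sigma> ` {..<n}. \<phi> i f * u i x)" for x
        using \<sigma> by (auto simp: bij_betw_def intro!: sum.reindex_cong[symmetric] intro: inj_on_subset)
      then show ?thesis using approx[of "\<sigma> ` {..<n}"] \<sigma> by (auto simp: d_def bij_betw_def)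
    qed
    then show ?thesis using LIMSEQ_le_const[OF lim] by auto
  qed
qed

section \<open>Rudin--Shapiro polynomials\<close>

text \<open>
  Coefficients of the Rudin--Shapiro pair \<open>P\<close> (flag \<open>True\<close>) and \<open>Q\<close> (flag \<open>False\<close>) of length \<open>2 ^ m\<close>. They are
  built by the doubling step \<open>P' = P + z ^ 2 ^ m * Q\<close>, \<open>Q' = P - z ^ 2 ^ m * Q\<close>. The signs are complex numbers
  because they multiply complex functions below.
\<close>

fun rudin_shapiro :: "bool \<Rightarrow> nat \<Rightarrow> nat \<Rightarrow> complex" where
  "rudin_shapiro b 0 k = 1"
| "rudin_shapiro b (Suc m) k =
     (if k < 2 ^ m then rudin_shapiro True m k
      else (if b then 1 else -1) * rudin_shapiro False m (k - 2 ^ m))"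

lemma rudin_shapiro_square: "rudin_shapiro b m k * rudin_shapiro b m k = 1"
proof (induction m arbitrary: b k)
  case (Suc m)
  show ?case
    using Suc.IH[of True k] Suc.IH[of False "k - 2 ^ m"] by (cases b) simp_all
qed simp

lemma norm_rudin_shapiro: "norm (rudin_shapiro b m k) = 1"
proof -
  have "norm (rudin_shapiro b m k) ^ 2 = 1"
    by (metis rudin_shapiro_square norm_mult norm_one power2_eq_square)
  then show ?thesis by (simp add: power2_eq_1_iff) (smt (verit) norm_ge_zero)
qed

lemma sum_lessThan_add:
  fixes f :: "nat \<Rightarrow> 'a::comm_monoid_add"
  shows "(\<Sum>k<m + n. f k) = (\<Sum>k<m. f k) + (\<Sum>k<n. f (m + k))"
  by (induction n) (simp_all add: add.assoc)

definition rudin_shapiro_poly :: "bool \<Rightarrow> nat \<Rightarrow> complex \<Rightarrow> complex" where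
  "rudin_shapiro_poly b m z = (\<Sum>k<2 ^ m. rudin_shapiro b m k * z ^ k)"

lemma rudin_shapiro_poly_Suc:
  "rudin_shapiro_poly b (Suc m) z =
     rudin_shapiro_poly True m z + (if b then 1 else -1) * (z ^ 2 ^ m * rudin_shapiro_poly False m z)"
proof -
  have "(2::nat) ^ Suc m = 2 ^ m + 2 ^ m" by simp
  then have "rudin_shapiro_poly b (Suc m) z =
      (\<Sum>k<2 ^ m. rudin_shapiro b (Suc m) k * z ^ k)
    + (\<Sum>k<2 ^ m. rudin_shapiro b (Suc m) (2 ^ m + k) * z ^ (2 ^ m + k))"
    unfolding rudin_shapiro_poly_def by (simp only: sum_lessThan_add)
  also have "(\<Sum>k<2 ^ m. rudin_shapiro b (Suc m) k * z ^ k) = rudin_shapiro_poly True m z"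
    unfolding rudin_shapiro_poly_def by (intro sum.cong) auto
  also have "(\<Sum>k<2 ^ m. rudin_shapiro b (Suc m) (2 ^ m + k) * z ^ (2 ^ m + k))
     = (if b then 1 else -1) * (z ^ 2 ^ m * rudin_shapiro_poly False m z)"
    unfolding rudin_shapiro_poly_def sum_distrib_left
    by (intro sum.cong) (auto simp: power_add)
  finally show ?thesis .
qed

text \<open>
  The doubling step and the parallelogram law: each step doubles the sum of the squares.
\<close>

lemma rudin_shapiro_poly_squares:
  assumes z: "norm z = 1"
  shows "(norm (rudin_shapiro_poly True m z))\<^sup>2 + (norm (rudin_shapiro_poly False m z))\<^sup>2 = 2 * 2 ^ m"
proof (induction m)
  case 0
  then show ?case by (simp add: rudin_shapiro_poly_def)
next
  case (Suc m)
  have par: "(norm (u + v))\<^sup>2 + (norm (u - v))\<^sup>2 = 2 * ((norm u)\<^sup>2 + (norm v)\<^sup>2)" for u v :: complex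
    unfolding cmod_power2 by (simp add: power2_eq_square algebra_simps)
  have "norm (z ^ 2 ^ m * rudin_shapiro_poly False m z) = norm (rudin_shapiro_poly False m z)"
    using z by (simp add: norm_mult norm_power)
  then show ?case
    using par[of "rudin_shapiro_poly True m z" "z ^ 2 ^ m * rudin_shapiro_poly False m z"] Suc
    by (simp add: rudin_shapiro_poly_Suc)
qed


section \<open>Disjoint translates inside a set of positive measure\<close>

lemma nonnegligible_Int_cball:
  fixes S :: "'a::euclidean_space set"
  assumes S: "\<not> negligible S" and r: "0 < r"
  obtains c where "\<not> negligible (S \<inter> cball c r)"
proof -
  have "\<exists>c. \<not> negligible (S \<inter> cball c r)"
  proof (rule ccontr)
    assume "\<not> ?thesis"
    then have neg: "negligible (S \<inter> cball c r)" for c by blast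
    have "negligible S"
    proof (rule locally_negligible_alt[THEN iffD2], rule ballI)
      fix x assume "x \<in> S"
      have "negligible (S \<inter> ball x r)" using neg[of x] by (rule negligible_subset) auto
      then show "\<exists>U. openin (top_of_set S) U \<and> x \<in> U \<and> negligible U"
        using \<open>x \<in> S\<close> r by (intro exI[of _ "S \<inter> ball x r"]) (auto intro: openin_open_Int)
    qed
    then show False using S by simp
  qed
  then show ?thesis using that by blast
qed

text \<open>
  Inner regularity gives a closed set, and cutting it with balls makes it compact.
\<close>

lemma compact_nonnegligible_subset:
  fixes S :: "'a::euclidean_space set"
  assumes S: "S \<in> lmeasurable" "0 < measure lebesgue S"
  obtains K where "compact K" "K \<subseteq> S" "\<not> negligible K"
proof -
  obtain T where T: "closed T" "T \<subseteq> S" "S - T \<in> lmeasurable"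
    "emeasure lebesgue (S - T) < ennreal (measure lebesgue S)"
    by (rule sets_lebesgue_inner_closed[OF fmeasurableD[OF S(1)] S(2)])
  have "\<not> negligible T"
  proof
    assume "negligible T"
    then have "measure lebesgue (S - T) = measure lebesgue S"
      using fmeasurableD[OF S(1)] by (intro measure_Diff_null_set) (simp_all only: negligible_iff_null_sets)
    then show False
      using T(4) unfolding emeasure_eq_measure2[OF T(3)] by (simp only: ennreal_less_iff measure_nonneg)
  qed
  then obtain c where c: "\<not> negligible (T \<inter> cball c 1)"
    using nonnegligible_Int_cball[of T 1] by auto
  show ?thesis
  proof (rule that)
    show "compact (T \<inter> cball c 1)" using T(1) by (rule closed_Int_compact) simp
    show "T \<inter> cball c 1 \<subseteq> S" using T(2) by blast
    show "\<not> negligible (T \<inter> cball c 1)" by (rule c)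
  qed
qed

text \<open>
  For a compact \<open>K\<close> in \<open>S\<close> and small \<open>t\<close>, all translates \<open>K - k t\<close> lie in an open set \<open>U\<close> whose measure exceeds that
  of \<open>K\<close> by less than the \<open>N\<close>-th part. They omit too little of \<open>U\<close> for their intersection to be negligible,
  and every point of the intersection has all its translates by \<open>k t\<close> in \<open>K\<close>. A piece of the intersection with
  diameter less than \<open>norm t\<close> has disjoint translates.
\<close>

lemma exists_separated_translates:
  fixes S :: "'a::euclidean_space set"
  assumes S: "S \<in> lmeasurable" "0 < measure lebesgue S" and N: "0 < N"
  obtains E t where "compact E" "0 < measure lebesgue E"
    "(\<Union>k<N. (+) (real k *\<^sub>R t) ` E) \<subseteq> S"
    "disjoint_family_on (\<lambda>k. (+) (real k *\<^sub>R t) ` E) {..<N}"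
proof -
  obtain K where K: "compact K" "K \<subseteq> S" "\<not> negligible K"
    by (rule compact_nonnegligible_subset[OF S])
  have Km: "K \<in> lmeasurable" by (rule lmeasurable_compact[OF K(1)])
  have K0: "0 < measure lebesgue K"
    using K(3) Km unfolding negligible_iff_measure by (simp only: zero_less_measure_iff simp_thms)
  define e where "e = measure lebesgue K / real N"
  have e: "0 < e" using K0 N by (simp add: e_def)
  obtain U where U: "open U" "K \<subseteq> U" "U - K \<in> lmeasurable" "emeasure lebesgue (U - K) < ennreal e"
    by (rule sets_lebesgue_outer_open[OF fmeasurableD[OF Km] e])
  have UK: "measure lebesgue (U - K) < e"
    using U(4) unfolding emeasure_eq_measure2[OF U(3)] by (simp only: ennreal_less_iff measure_nonneg)
  have "K \<union> (U - K) = U" using U by blast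
  then have Um: "U \<in> lmeasurable" using fmeasurable.Un[OF Km U(3)] by simp
  have UK': "measure lebesgue U < measure lebesgue K + e"
    using UK measurable_measure_Diff[OF Um fmeasurableD[OF Km] U(2)] by simp
  obtain \<delta> where \<delta>: "0 < \<delta>" "(\<Union>x\<in>K. ball x \<delta>) \<subseteq> U"
    using compact_subset_open_imp_ball_epsilon_subset[OF K(1) U(1,2)] .
  obtain b :: 'a where b: "norm b = 1" using norm_Basis SOME_Basis by blast
  define t where "t = (\<delta> / real (2 * N)) *\<^sub>R b"
  have t0: "0 < norm t" using \<delta> N b by (simp add: t_def)
  have tk: "norm (real k *\<^sub>R t) < \<delta>" if "k < N" for k
  proof -
    have "real k * (\<delta> / real (2 * N)) < real N * (\<delta> / real (2 * N)) * 2"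
      using that \<delta> N by (auto simp: field_simps)
    then show ?thesis using \<delta> N b by (simp add: t_def)
  qed
  define Kt where "Kt k = (+) (- (real k *\<^sub>R t)) ` K" for k :: nat
  have KtU: "Kt k \<subseteq> U" if "k < N" for k
  proof
    fix y assume "y \<in> Kt k"
    then obtain x where "x \<in> K" "y = - (real k *\<^sub>R t) + x" by (auto simp: Kt_def)
    then have "x \<in> K" "y \<in> ball x \<delta>" using tk[OF that] by (auto simp: dist_norm)
    then show "y \<in> U" using \<delta> by blast
  qed
  have Ktc: "compact (Kt k)" for k unfolding Kt_def using K by (intro compact_translation)
  have Ktm: "Kt k \<in> lmeasurable" for k by (rule lmeasurable_compact[OF Ktc])
  have Ktmeas: "measure lebesgue (Kt k) = measure lebesgue K" for k
    unfolding Kt_def by (rule measure_translation)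
  define E0 where "E0 = (\<Inter>k<N. Kt k)"
  have E0c: "closed E0" unfolding E0_def using Ktc by (intro closed_INT) (auto intro: compact_imp_closed)
  have "\<not> negligible E0"
  proof
    assume "negligible E0"
    then have "measure lebesgue U = measure lebesgue (U - E0)"
      using fmeasurableD[OF Um]
      by (intro measure_Diff_null_set[symmetric]) (simp_all only: negligible_iff_null_sets)
    also have "U - E0 = (\<Union>k<N. U - Kt k)" by (auto simp: E0_def)
    also have "measure lebesgue \<dots> \<le> (\<Sum>k<N. measure lebesgue (U - Kt k))"
      using Um Ktm by (intro measure_UNION_le) (auto intro: fmeasurableD)
    also have "\<dots> = (\<Sum>k<N. measure lebesgue U - measure lebesgue K)"
      using KtU Um Ktm Ktmeas by (intro sum.cong) (simp_all add: measurable_measure_Diff fmeasurableD)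
    also have "\<dots> < (\<Sum>k<N. e)"
      using UK' N by (intro sum_strict_mono) (auto simp: lessThan_empty_iff)
    also have "\<dots> = measure lebesgue K" using N by (simp add: e_def)
    also have "\<dots> \<le> measure lebesgue U" using U(2) Um Km by (intro measure_mono_fmeasurable) (auto intro: fmeasurableD)
    finally show False by simp
  qed
  then obtain c where c: "\<not> negligible (E0 \<inter> cball c (norm t / 3))"
    using nonnegligible_Int_cball[of E0 "norm t / 3"] t0 by auto
  define E where "E = E0 \<inter> cball c (norm t / 3)"
  show ?thesis
  proof (rule that[of E t])
    show cE: "compact E" unfolding E_def using E0c by (intro closed_Int_compact) auto
    show "0 < measure lebesgue E"
      using c lmeasurable_compact[OF cE] unfolding negligible_iff_measure E_def[symmetric]
      by (simp only: zero_less_measure_iff simp_thms)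
    show "(\<Union>k<N. (+) (real k *\<^sub>R t) ` E) \<subseteq> S"
    proof
      fix y assume "y \<in> (\<Union>k<N. (+) (real k *\<^sub>R t) ` E)"
      then obtain k x where x: "k < N" "x \<in> E" "y = real k *\<^sub>R t + x" by auto
      then have "x \<in> Kt k" by (auto simp: E_def E0_def)
      then show "y \<in> S" using x K by (auto simp: Kt_def)
    qed
    show "disjoint_family_on (\<lambda>k. (+) (real k *\<^sub>R t) ` E) {..<N}"
      unfolding disjoint_family_on_def
    proof (intro ballI impI)
      fix k l :: nat assume "k \<noteq> l"
      show "(+) (real k *\<^sub>R t) ` E \<inter> (+) (real l *\<^sub>R t) ` E = {}"
      proof (rule ccontr)
        assume "\<not> ?thesis"
        then obtain x y where xy: "x \<in> E" "y \<in> E" "real k *\<^sub>R t + x = real l *\<^sub>R t + y" by auto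
        then have "y - x = (real k - real l) *\<^sub>R t" by (simp add: algebra_simps)
        then have "norm (y - x) = \<bar>real k - real l\<bar> * norm t" by simp
        moreover have "1 \<le> \<bar>real k - real l\<bar>" using \<open>k \<noteq> l\<close> by linarith
        ultimately have "norm t \<le> norm (y - x)"
          using mult_right_mono[of 1 "\<bar>real k - real l\<bar>" "norm t"] by simp
        moreover have "dist y x \<le> dist c y + dist c x" by (metis dist_commute dist_triangle)
        moreover have "dist c x \<le> norm t / 3" "dist c y \<le> norm t / 3"
          using xy by (auto simp: E_def)
        ultimately show False using t0 by (simp add: dist_norm)
      qed
    qed
  qed
qed


section \<open>Exponentials and signed sums of translates\<close>

lemma exponential_add: "exponential l (x + y) = exponential l x * exponential l y"
  by (simp add: exponential_def inner_add_right distrib_left exp_add)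

lemma exponential_scale_nat: "exponential l (real k *\<^sub>R t) = exponential l t ^ k"
  by (simp add: exponential_def exp_of_nat_mult[symmetric] mult_ac)

lemma norm_exponential [simp]: "norm (exponential l x) = 1"
  by (simp add: exponential_def)

lemma exponential_borel [measurable]: "exponential l \<in> borel_measurable borel"
  unfolding exponential_def by measurable

lemma integral_exponential_translate:
  fixes E :: "'a::euclidean_space set"
  assumes E: "compact E" and sub: "(+) v ` E \<subseteq> \<Omega>" and \<Omega>: "\<Omega> \<in> sets lebesgue"
  shows "(\<integral>x. exponential l x * indicator ((+) v ` E) x \<partial>lebesgue_on \<Omega>)
       = exponential l v * (\<integral>x. exponential l x * indicator E x \<partial>lborel)"
proof -
  have [measurable]: "E \<in> sets borel" "(+) v ` E \<in> sets borel"
    using E compact_translation[OF E, of v] by (auto intro: borel_compact)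
  have "(\<integral>x. exponential l x * indicator ((+) v ` E) x \<partial>lebesgue_on \<Omega>)
      = (\<integral>x. indicator \<Omega> x *\<^sub>R (exponential l x * indicator ((+) v ` E) x) \<partial>lebesgue)"
    using \<Omega> by (intro integral_restrict_space) auto
  also have "\<dots> = (\<integral>x. exponential l x * indicator ((+) v ` E) x \<partial>lebesgue)"
    using sub by (intro Bochner_Integration.integral_cong) (auto split: split_indicator)
  also have "\<dots> = (\<integral>x. exponential l x * indicator ((+) v ` E) x \<partial>lborel)"
    by (intro integral_completion) measurable
  also have "\<dots> = (\<integral>x. exponential l x * indicator ((+) v ` E) x \<partial>distr lborel borel ((+) v))"
    by (simp add: lborel_distr_plus)
  also have "\<dots> = (\<integral>x. exponential l (v + x) * indicator ((+) v ` E) (v + x) \<partial>lborel)"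
    by (intro integral_distr) measurable
  also have "\<dots> = (\<integral>x. exponential l v * (exponential l x * indicator E x) \<partial>lborel)"
    by (intro Bochner_Integration.integral_cong) (auto simp: exponential_add split: split_indicator)
  finally show ?thesis by simp
qed

lemma Lp_unimodular:
  assumes p: "0 < p" and f: "f \<in> borel_measurable (lebesgue_on \<Omega>)"
    and D: "D \<in> sets (lebesgue_on \<Omega>)" "emeasure (lebesgue_on \<Omega>) D < \<infinity>"
    and fD: "\<And>x. norm (f x) = indicator D x"
  shows "f \<in> Lp_space p \<Omega>" "Lp_norm p \<Omega> f = measure (lebesgue_on \<Omega>) D powr (1 / p)"
proof -
  have eq: "norm (f x) powr p = indicator D x" for x
    using p fD[of x] by (auto split: split_indicator)
  show "f \<in> Lp_space p \<Omega>" using f D by (simp add: Lp_space_def eq)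
  show "Lp_norm p \<Omega> f = measure (lebesgue_on \<Omega>) D powr (1 / p)"
    using sets.sets_into_space[OF D(1)] by (simp add: Lp_norm_def eq Int_absorb2)
qed

text \<open>
  The test functions of the proof. Their modulus is an indicator function for any unimodular coefficients, and
  their pairing with an exponential factors into a polynomial in \<open>exponential l t\<close> and the pairing
  with the indicator of \<open>E\<close>. The integral over \<open>E\<close> is taken over the whole space, where the measure is
  invariant under translation.
\<close>

lemma signed_translates:
  fixes E :: "'a::euclidean_space set" and a :: "nat \<Rightarrow> complex"
  assumes \<Omega>: "\<Omega> \<in> lmeasurable" and E: "compact E"
    and D\<Omega>: "(\<Union>k<N. (+) (real k *\<^sub>R t) ` E) \<subseteq> \<Omega>"
    and dis: "disjoint_family_on (\<lambda>k. (+) (real k *\<^sub>R t) ` E) {..<N}"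
    and a: "\<And>k. norm (a k) = 1"
  defines "D \<equiv> \<Union>k<N. (+) (real k *\<^sub>R t) ` E"
    and "g \<equiv> \<lambda>x. \<Sum>k<N. a k * indicator ((+) (real k *\<^sub>R t) ` E) x"
  shows "D \<in> sets (lebesgue_on \<Omega>)" "emeasure (lebesgue_on \<Omega>) D < \<infinity>"
    "measure (lebesgue_on \<Omega>) D = real N * measure lebesgue E"
    "g \<in> borel_measurable (lebesgue_on \<Omega>)"
    "\<And>x. norm (g x) = indicator D x"
    "\<And>l. (\<integral>x. exponential l x * g x \<partial>lebesgue_on \<Omega>)
      = (\<Sum>k<N. a k * exponential l t ^ k) * (\<integral>x. exponential l x * indicator E x \<partial>lborel)"
proof -
  let ?T = "\<lambda>k. (+) (real k *\<^sub>R t) ` E"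
  have sub: "?T k \<subseteq> \<Omega>" if "k < N" for k using D\<Omega> that by blast
  have \<Omega>s: "\<Omega> \<in> sets lebesgue" using \<Omega> by (rule fmeasurableD)
  have finite_on: "emeasure (lebesgue_on \<Omega>) A < \<infinity>" if "A \<in> lmeasurable" "A \<subseteq> \<Omega>" for A
  proof -
    have "emeasure (lebesgue_on \<Omega>) A = emeasure lebesgue A"
      using that \<Omega>s by (intro emeasure_restrict_space) auto
    also have "\<dots> < \<infinity>" using that(1) by (auto simp only: fmeasurable_def infinity_ennreal_def)
    finally show ?thesis .
  qed
  have Tc: "compact (?T k)" for k using E by (rule compact_translation)
  have Tm: "?T k \<in> lmeasurable" for k by (rule lmeasurable_compact[OF Tc])
  have Ts: "?T k \<in> sets (lebesgue_on \<Omega>)" if "k < N" for k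
    using sub[OF that] Tm[of k] \<Omega>s by (auto simp: sets_restrict_space_iff intro: fmeasurableD)
  show Ds: "D \<in> sets (lebesgue_on \<Omega>)" unfolding D_def using Ts by auto
  have Dsub: "D \<subseteq> \<Omega>" unfolding D_def using sub by auto
  have Dm: "D \<in> lmeasurable" unfolding D_def using Tm by (intro fmeasurable.finite_UN) auto
  show "emeasure (lebesgue_on \<Omega>) D < \<infinity>"
    using finite_on[OF Dm Dsub] .
  have "measure (lebesgue_on \<Omega>) D = measure lebesgue D"
    using Dsub \<Omega>s by (simp add: measure_restrict_space)
  also have "\<dots> = (\<Sum>k<N. measure lebesgue (?T k))"
    unfolding D_def using fmeasurableD[OF Tm] fmeasurableD2[OF Tm] dis
    by (intro measure_finite_Union) (auto simp del: emeasure_completion)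
  finally show "measure (lebesgue_on \<Omega>) D = real N * measure lebesgue E"
    by (simp add: measure_translation)
  have im: "(indicator (?T k) :: 'a \<Rightarrow> complex) \<in> borel_measurable (lebesgue_on \<Omega>)" if "k < N" for k
    using Ts[OF that] by (rule borel_measurable_indicator)
  show "g \<in> borel_measurable (lebesgue_on \<Omega>)"
    unfolding g_def using im by (intro borel_measurable_sum borel_measurable_times borel_measurable_const) auto
  show "norm (g x) = indicator D x" for x
  proof (cases "x \<in> D")
    case True
    then obtain k where k: "k < N" "x \<in> ?T k" by (auto simp: D_def)
    have "x \<notin> ?T j" if "j < N" "j \<noteq> k" for j
      using disjoint_family_onD[OF dis, of j k] that k by auto
    then have "g x = (\<Sum>j<N. if j = k then a j else 0)"
      unfolding g_def using k(2) by (intro sum.cong) (auto simp: indicator_def)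
    then show ?thesis using True k a by simp
  next
    case False
    then have "g x = 0" unfolding g_def D_def by (intro sum.neutral) (auto simp: indicator_def)
    then show ?thesis using False by simp
  qed
  fix l
  have em: "exponential l \<in> borel_measurable (lebesgue_on \<Omega>)"
    by (intro measurable_restrict_space1 measurable_completion) simp
  have int: "integrable (lebesgue_on \<Omega>) (\<lambda>x. exponential l x * indicator (?T k) x)" if "k < N" for k
  proof (rule Bochner_Integration.integrable_bound)
    show "integrable (lebesgue_on \<Omega>) (indicator (?T k) :: 'a \<Rightarrow> real)"
      using Ts[OF that] finite_on[OF Tm sub[OF that]] by (rule integrable_real_indicator)
    show "(\<lambda>x. exponential l x * indicator (?T k) x) \<in> borel_measurable (lebesgue_on \<Omega>)"
      using em im[OF that] by (rule borel_measurable_times)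
  qed (auto simp: norm_mult split: split_indicator)
  have "(\<integral>x. exponential l x * g x \<partial>lebesgue_on \<Omega>)
      = (\<integral>x. (\<Sum>k<N. a k * (exponential l x * indicator (?T k) x)) \<partial>lebesgue_on \<Omega>)"
    unfolding g_def sum_distrib_left
    by (intro Bochner_Integration.integral_cong refl sum.cong mult.left_commute)
  also have "\<dots> = (\<Sum>k<N. \<integral>x. a k * (exponential l x * indicator (?T k) x) \<partial>lebesgue_on \<Omega>)"
    using int by (intro Bochner_Integration.integral_sum integrable_mult_right) auto
  also have "\<dots> = (\<Sum>k<N. a k * (exponential l t ^ k * (\<integral>x. exponential l x * indicator E x \<partial>lborel)))"
    using integral_exponential_translate[OF E sub \<Omega>s]
    by (intro sum.cong) (simp_all add: exponential_scale_nat)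
  finally show "(\<integral>x. exponential l x * g x \<partial>lebesgue_on \<Omega>)
      = (\<Sum>k<N. a k * exponential l t ^ k) * (\<integral>x. exponential l x * indicator E x \<partial>lborel)"
    by (simp add: sum_distrib_right mult.assoc)
qed

section \<open>Nonexistence of frames of exponentials\<close>

text \<open>
  Both ranges of \<open>p\<close> lead to the same contradiction, that \<open>N powr \<bar>1 / 2 - 1 / p\<bar>\<close> stays bounded
  as \<open>N\<close> runs through the powers of two.
\<close>

theorem no_unconditional_frame_of_exponentials:
  fixes \<Omega> :: "'a::euclidean_space set"
  assumes \<Omega>: "\<Omega> \<in> lmeasurable" "0 < measure lebesgue \<Omega>" and p: "1 < p" "p \<noteq> 2"
  shows "\<not> unconditional_Schauder_frame p \<Omega> \<Lambda> exponential \<phi>"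
proof
  assume fr: "unconditional_Schauder_frame p \<Omega> \<Lambda> exponential \<phi>"
  let ?M = "lebesgue_on \<Omega>"
  obtain C where C: "\<And>F f (h :: 'a \<Rightarrow> complex) D. \<lbrakk>finite F; F \<subseteq> \<Lambda>; f \<in> Lp_space p \<Omega>; h \<in> borel_measurable ?M;
      D \<in> sets ?M; emeasure ?M D < \<infinity>; \<And>x. norm (h x) \<le> indicator D x\<rbrakk> \<Longrightarrow>
    (\<Sum>i\<in>F. norm (\<phi> i f) * norm (\<integral>x. exponential i x * h x \<partial>?M))
      \<le> C * Lp_norm p \<Omega> f * measure ?M D powr (1 - 1 / p)"
    by (rule frame_absolute_bound[OF fr p(1)]) blast
  define \<alpha> where "\<alpha> = \<bar>1 / 2 - 1 / p\<bar>"
  have \<alpha>: "0 < \<alpha>" using p by (auto simp: \<alpha>_def field_simps)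
  have bound: "(2 ^ m) powr \<alpha> \<le> 2 * C" for m :: nat
  proof -
    define N :: nat where "N = 2 ^ m"
    have N: "0 < N" "real N = 2 ^ m" by (simp_all add: N_def)
    obtain E t where E: "compact E" "0 < measure lebesgue E"
      and sub: "(\<Union>k<N. (+) (real k *\<^sub>R t) ` E) \<subseteq> \<Omega>"
      and dis: "disjoint_family_on (\<lambda>k. (+) (real k *\<^sub>R t) ` E) {..<N}"
      by (rule exists_separated_translates[OF \<Omega> N(1)]) blast
    define \<mu> where "\<mu> = measure lebesgue E"
    have \<mu>: "0 < \<mu>" using E by (simp add: \<mu>_def)
    define D where "D = (\<Union>k<N. (+) (real k *\<^sub>R t) ` E)"
    define g where "g b = (\<lambda>x. \<Sum>k<N. rudin_shapiro b m k * indicator ((+) (real k *\<^sub>R t) ` E) x)" for b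
    define J where "J l = norm (\<integral>x. exponential l x * indicator E x \<partial>lborel)" for l :: 'a
    note st = signed_translates[OF \<Omega>(1) E(1) sub dis norm_rudin_shapiro[where m=m], folded D_def \<mu>_def]
    have Ds: "D \<in> sets ?M" "emeasure ?M D < \<infinity>" and D\<mu>: "measure ?M D = real N * \<mu>"
      by - (rule st(1), rule st(2), rule st(3))
    have gm: "g b \<in> borel_measurable ?M" and gn: "norm (g b x) = indicator D x" for b x
      unfolding g_def by - (rule st(4), rule st(5))
    have gJ: "norm (\<integral>x. exponential l x * g b x \<partial>?M) = norm (rudin_shapiro_poly b m (exponential l t)) * J l" for b l
      unfolding g_def st(6) by (simp add: J_def rudin_shapiro_poly_def N_def norm_mult)
    have gL: "g b \<in> Lp_space p \<Omega>" "Lp_norm p \<Omega> (g b) = (N * \<mu>) powr (1 / p)" for b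
      using Lp_unimodular[OF _ gm Ds gn] p D\<mu> by simp_all
    \<comment> \<open>The indicator of \<open>E\<close> is itself a signed sum, with one translate.\<close>
    have E1: "disjoint_family_on (\<lambda>k. (+) (real k *\<^sub>R t) ` E) {..<1}"
      by (simp add: disjoint_family_on_def)
    define h :: "'a \<Rightarrow> complex" where "h = indicator E"
    have E\<Omega>: "E \<subseteq> \<Omega>" using sub N by force
    then have E\<Omega>1: "(\<Union>k<1. (+) (real k *\<^sub>R t) ` E) \<subseteq> \<Omega>" by (simp add: lessThan_Suc)
    note sh = signed_translates[OF \<Omega>(1) E(1) E\<Omega>1 E1, where a = "\<lambda>_. 1"]
    have hm: "h \<in> borel_measurable ?M" and Es: "E \<in> sets ?M" "emeasure ?M E < \<infinity>"
      and E\<mu>: "measure ?M E = \<mu>" and hn: "norm (h x) = indicator E x"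
      and hJ: "norm (\<integral>x. exponential l x * h x \<partial>?M) = J l" for x l
      using sh by (simp_all add: J_def h_def \<mu>_def lessThan_Suc)
    have hL: "h \<in> Lp_space p \<Omega>" "Lp_norm p \<Omega> h = \<mu> powr (1 / p)"
      using Lp_unimodular[OF _ hm Es hn] p E\<mu> by simp_all
    have rs: "(norm (rudin_shapiro_poly True m z))\<^sup>2 + (norm (rudin_shapiro_poly False m z))\<^sup>2 = 2 * real N"
      if "norm z = 1" for z
      using rudin_shapiro_poly_squares[OF that, of m] N by simp
    show ?thesis
    proof (cases "p < 2")
      case True
      \<comment> \<open>The indicator of \<open>E\<close> is small on the frequency side compared with the two signed sums.\<close>
      have lower: "sqrt N * J l \<le> norm (\<integral>x. exponential l x * g True x \<partial>?M) + norm (\<integral>x. exponential l x * g False x \<partial>?M)" for l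
      proof -
        let ?P = "norm (rudin_shapiro_poly True m (exponential l t))"
        let ?Q = "norm (rudin_shapiro_poly False m (exponential l t))"
        have "real N \<le> (?P + ?Q)\<^sup>2"
          using rs[OF norm_exponential, of l t] mult_nonneg_nonneg[of ?P ?Q]
          by (simp add: power2_sum)
        then have "sqrt N \<le> ?P + ?Q" by (simp add: real_le_lsqrt real_le_rsqrt)
        then have "sqrt N * J l \<le> (?P + ?Q) * J l" by (intro mult_right_mono) (auto simp: J_def)
        then show ?thesis by (simp add: gJ distrib_right)
      qed
      have "norm (\<integral>x. h x * h x \<partial>?M) \<le> 2 * (C * \<mu> powr (1 / p) * (N * \<mu>) powr (1 - 1 / p)) / sqrt N"
      proof (rule frame_pairing_le[OF fr p(1) hL(1) hm Es])
        show "norm (h x) \<le> indicator E x" for x by (simp add: hn)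
        fix F assume F: "finite F" "F \<subseteq> \<Lambda>"
        have b: "(\<Sum>i\<in>F. norm (\<phi> i h) * norm (\<integral>x. exponential i x * g b x \<partial>?M))
            \<le> C * \<mu> powr (1 / p) * (N * \<mu>) powr (1 - 1 / p)" for b
          using C[OF F hL(1) gm Ds, of b] gn hL(2) D\<mu> by simp
        have "sqrt N * (\<Sum>i\<in>F. norm (\<phi> i h) * norm (\<integral>x. exponential i x * h x \<partial>?M))
            = (\<Sum>i\<in>F. norm (\<phi> i h) * (sqrt N * J i))"
          unfolding hJ sum_distrib_left by (intro sum.cong refl mult.left_commute)
        also have "\<dots> \<le> (\<Sum>i\<in>F. norm (\<phi> i h) * (norm (\<integral>x. exponential i x * g True x \<partial>?M) + norm (\<integral>x. exponential i x * g False x \<partial>?M)))"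
          by (intro sum_mono mult_left_mono lower) auto
        also have "\<dots> \<le> 2 * (C * \<mu> powr (1 / p) * (N * \<mu>) powr (1 - 1 / p))"
          using b[of True] b[of False] by (simp add: distrib_left sum.distrib)
        finally show "(\<Sum>i\<in>F. norm (\<phi> i h) * norm (\<integral>x. exponential i x * h x \<partial>?M))
            \<le> 2 * (C * \<mu> powr (1 / p) * (N * \<mu>) powr (1 - 1 / p)) / sqrt N"
          using N by (simp add: field_simps)
      qed
      moreover have "(\<integral>x. h x * h x \<partial>?M) = \<mu>"
      proof -
        have "(\<integral>x. h x * h x \<partial>?M) = (\<integral>x. indicator E x *\<^sub>R (1::complex) \<partial>?M)"
          by (intro Bochner_Integration.integral_cong) (auto simp: h_def split: split_indicator)
        then show ?thesis using Es E\<mu> E\<Omega> by (simp add: scaleR_conv_of_real Int_absorb2)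
      qed
      ultimately have "\<mu> \<le> 2 * (C * \<mu> powr (1 / p) * (N * \<mu>) powr (1 - 1 / p)) / sqrt N"
        using \<mu> by simp
      also have "\<dots> = \<mu> * (2 * C / N powr \<alpha>)"
      proof -
        have "\<mu> powr (1 / p) * \<mu> powr (1 - 1 / p) = \<mu>" using \<mu> by (simp flip: powr_add)
        moreover have "N powr (1 - 1 / p) / sqrt N = 1 / N powr \<alpha>"
        proof -
          have "\<alpha> = 1 / p - 1 / 2" using True p by (simp add: \<alpha>_def field_simps)
          then have "N powr (1 - 1 / p) * N powr \<alpha> = N powr (1 / 2)" by (simp flip: powr_add)
          then show ?thesis using N by (simp add: powr_half_sqrt field_simps)
        qed
        ultimately show ?thesis using \<mu> N by (simp add: powr_mult field_simps)
      qed
      finally show ?thesis using \<mu> N by (simp add: field_simps)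
    next
      case False
      then have p2: "2 < p" using p by simp
      \<comment> \<open>The signed sum is small on the frequency side for its norm; the factor \<open>2\<close> in place of \<open>sqrt 2\<close> gives both cases the same bound.\<close>
      have upper: "norm (\<integral>x. exponential l x * g True x \<partial>?M) \<le> 2 * sqrt N * J l" for l
      proof -
        let ?P = "norm (rudin_shapiro_poly True m (exponential l t))"
        have "?P\<^sup>2 \<le> 2 * real N" using rs[OF norm_exponential, of l t] by (smt (verit) zero_le_power2)
        also have "\<dots> \<le> (2 * sqrt N)\<^sup>2" by (simp add: power_mult_distrib)
        finally have "?P \<le> 2 * sqrt N" by (rule power2_le_imp_le) simp
        then show ?thesis unfolding gJ by (intro mult_right_mono) (auto simp: J_def)
      qed
      have "norm (\<integral>x. g True x * g True x \<partial>?M) \<le> 2 * sqrt N * (C * (N * \<mu>) powr (1 / p) * \<mu> powr (1 - 1 / p))"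
      proof (rule frame_pairing_le[OF fr p(1) gL(1) gm Ds])
        show "norm (g True x) \<le> indicator D x" for x by (simp add: gn)
        fix F assume F: "finite F" "F \<subseteq> \<Lambda>"
        have "(\<Sum>i\<in>F. norm (\<phi> i (g True)) * norm (\<integral>x. exponential i x * g True x \<partial>?M))
           \<le> (\<Sum>i\<in>F. norm (\<phi> i (g True)) * (2 * sqrt N * J i))"
          by (intro sum_mono mult_left_mono upper) auto
        also have "\<dots> = 2 * sqrt N * (\<Sum>i\<in>F. norm (\<phi> i (g True)) * norm (\<integral>x. exponential i x * h x \<partial>?M))"
          unfolding hJ sum_distrib_left by (intro sum.cong refl mult.left_commute)
        also have "\<dots> \<le> 2 * sqrt N * (C * (N * \<mu>) powr (1 / p) * \<mu> powr (1 - 1 / p))"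
          using C[OF F gL(1)[of True] hm Es] hn gL(2) E\<mu> by (intro mult_left_mono) simp_all
        finally show "(\<Sum>i\<in>F. norm (\<phi> i (g True)) * norm (\<integral>x. exponential i x * g True x \<partial>?M))
           \<le> 2 * sqrt N * (C * (N * \<mu>) powr (1 / p) * \<mu> powr (1 - 1 / p))" .
      qed
      moreover have "(\<integral>x. g True x * g True x \<partial>?M) = complex_of_real (N * \<mu>)"
      proof -
        have real: "g True x \<in> \<real>" for x
        proof -
          have "rudin_shapiro b m k \<in> \<real>" for b k
            by (induction m arbitrary: b k) auto
          then show ?thesis unfolding g_def by (intro sum_in_Reals Reals_mult) (auto simp: indicator_def)
        qed
        have "g True x * g True x = indicator D x *\<^sub>R 1" for x
        proof -
          obtain r where r: "g True x = complex_of_real r" using real[of x] by (auto elim: Reals_cases)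
          then have "\<bar>r\<bar> = indicator D x" using gn[of True x] by simp
          then have "r * r = indicator D x" by (metis abs_mult_self_eq indicator_times_eq_if(1) mult.right_neutral indicator_simps mult_zero_left mult_1)
          then show ?thesis using r by (simp add: scaleR_conv_of_real flip: of_real_mult)
        qed
        then have "(\<integral>x. g True x * g True x \<partial>?M) = (\<integral>x. indicator D x *\<^sub>R (1::complex) \<partial>?M)"
          by simp
        then show ?thesis using Ds D\<mu> sub by (simp add: scaleR_conv_of_real Int_absorb2 D_def)
      qed
      ultimately have "N * \<mu> \<le> 2 * sqrt N * (C * (N * \<mu>) powr (1 / p) * \<mu> powr (1 - 1 / p))"
        using \<mu> by (simp add: norm_mult)
      also have "\<dots> = N * \<mu> * (2 * C / N powr \<alpha>)"
      proof -
        have \<mu>p: "\<mu> powr (1 / p) * \<mu> powr (1 - 1 / p) = \<mu>" using \<mu> by (simp flip: powr_add)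
        have Np: "sqrt N * N powr (1 / p) = N / N powr \<alpha>"
        proof -
          have "\<alpha> = 1 / 2 - 1 / p" using p2 by (simp add: \<alpha>_def field_simps)
          then have "N powr (1 / 2) * N powr (1 / p) * N powr \<alpha> = N"
            using N by (simp flip: powr_add)
          then show ?thesis using N by (simp add: powr_half_sqrt field_simps)
        qed
        have "2 * sqrt N * (C * (N * \<mu>) powr (1 / p) * \<mu> powr (1 - 1 / p))
            = 2 * C * (sqrt N * N powr (1 / p)) * (\<mu> powr (1 / p) * \<mu> powr (1 - 1 / p))"
          using \<mu> N by (simp add: powr_mult)
        then show ?thesis unfolding Np \<mu>p by simp
      qed
      finally show ?thesis using \<mu> N by (simp add: field_simps)
    qed
  qed
  obtain m :: nat where m: "(2 * \<bar>C\<bar> + 1) powr (1 / \<alpha>) < 2 ^ m"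
    using real_arch_pow[of 2] by auto
  have "2 * \<bar>C\<bar> + 1 = ((2 * \<bar>C\<bar> + 1) powr (1 / \<alpha>)) powr \<alpha>"
    using \<alpha> by (simp add: powr_powr)
  also have "\<dots> \<le> (2 ^ m) powr \<alpha>" using m \<alpha> by (intro powr_mono2) auto
  also have "\<dots> \<le> 2 * C" by (rule bound)
  finally show False by linarith
qed

theorem theorem1p2:
  fixes \<Omega> :: "(real ^ 'd) set"
  assumes "\<Omega> \<in> lmeasurable" and "measure lebesgue \<Omega> > 0"
  shows "(\<forall>p::real. 1 < p \<and> p < 2 \<longrightarrow>
            \<not> (\<exists>\<Lambda> \<phi>. unconditional_Schauder_frame p \<Omega> \<Lambda> exponential \<phi>)) \<and>
         (interior \<Omega> \<noteq> {} \<longrightarrow>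
            (\<forall>p::real. 2 < p \<longrightarrow>
              \<not> (\<exists>\<Lambda> \<phi>. unconditional_Schauder_frame p \<Omega> \<Lambda> exponential \<phi>)))"
  using no_unconditional_frame_of_exponentials[OF assms] by auto

end
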